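(* Let $c\ge 0$ be a constant. For all sufficiently large $n$, for every $c\log n$-random labeled graph $G$ on $n$ nodes, in model II there is a routing scheme with stretch factor at most $1.5$ in which $n-1-(c+3)\log n$ nodes have local routing functions stored in at most $\lceil\log(n+1)\rceil+O(1)$ bits each and $1+(c+3)\log n$ nodes have local routing functions stored in at most $3n$ bits each; the complete scheme uses fewer than $(3c+20)n\log n$ bits.
   Context: $C(x\mid y)$ is Kolmogorov complexity w.r.t. a fixed universal Turing machine; $\log$ is base 2. A labeled graph $G$ on $V=\{1,\dots,n\}$ is encoded by $E(G)\in\{0,1\}^{n(n-1)/2}$ (bit $i$ indicates the $i$-th possible edge in lexicographic order); with $\mathcal G$ the set of all labeled graphs on $V$, $G$ is $\delta(n)$-random if $C(E(G)\mid n,\delta,\mathcal G)\ge n(n-1)/2-\delta(n)$. A routing scheme consists of a local routing function at every node $u$ returning, for each destination $v\ne u$, an edge at $u$; following them yields a route. Its stretch factor is the maximum over pairs $u\ne v$ of (length of route from $u$ to $v$)/(distance from $u$ to $v$). Model II: each node knows for free its neighbours' labels and which edge leads to each; node labels are the original labels $1,\dots,n$ unless stated otherwise. *)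

theory Defs
  imports Complex_Main "HOL-Library.Nat_Bijection"
begin

datatype recf = Z | S | Proj nat | Cn recf "recf list" | Pr recf recf | Mn recf

inductive eval :: "recf \<Rightarrow> nat list \<Rightarrow> nat \<Rightarrow> bool" where
  evZ: "eval Z xs 0"
| evS: "eval S (x # xs) (Suc x)"
| evProj: "i < length xs \<Longrightarrow> eval (Proj i) xs (xs ! i)"
| evCn: "list_all2 (\<lambda>g y. eval g xs y) gs ys \<Longrightarrow> eval f ys z \<Longrightarrow> eval (Cn f gs) xs z"
| evPr0: "eval f xs y \<Longrightarrow> eval (Pr f g) (0 # xs) y"
| evPrS: "eval (Pr f g) (n # xs) y \<Longrightarrow> eval g (n # y # xs) z \<Longrightarrow> eval (Pr f g) (Suc n # xs) z"
| evMn: "eval f (y # xs) 0 \<Longrightarrow> (\<forall>k<y. \<exists>m>0. eval f (k # xs) m) \<Longrightarrow> eval (Mn f) xs y"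

text \<open>Standard bijection between binary strings and naturals: the empty string is 0,
  and a string w is mapped to (the number with binary representation 1w) minus 1.\<close>
fun bin_val :: "bool list \<Rightarrow> nat" where
  "bin_val [] = 1"
| "bin_val (b # bs) = 2 * bin_val bs + (if b then 1 else 0)"

definition code :: "bool list \<Rightarrow> nat" where
  "code w = bin_val (rev w) - 1"

definition universal :: "recf \<Rightarrow> bool" where
  "universal U \<longleftrightarrow>
     (\<forall>f. \<exists>c::nat. \<forall>p y x. eval f [code p, y] x \<longrightarrow>
        (\<exists>q. eval U [code q, y] x \<and> length q \<le> length p + c))"

definition KC :: "recf \<Rightarrow> bool list \<Rightarrow> nat \<Rightarrow> nat" where
  "KC U x y = (LEAST k. \<exists>p. length p = k \<and> eval U [code p, y] (code x))"

definition is_graph :: "nat \<Rightarrow> (nat \<Rightarrow> nat \<Rightarrow> bool) \<Rightarrow> bool" where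
  "is_graph n E \<longleftrightarrow> (\<forall>u v. E u v \<longrightarrow> u \<in> {1..n} \<and> v \<in> {1..n} \<and> u \<noteq> v \<and> E v u)"

definition edge_code :: "nat \<Rightarrow> (nat \<Rightarrow> nat \<Rightarrow> bool) \<Rightarrow> bool list" where
  "edge_code n E = concat (map (\<lambda>i. map (\<lambda>j. E i j) [Suc i..<Suc n]) [1..<Suc n])"

text \<open>Condition (n, delta): n (which determines the class of all labeled graphs on {1..n})
  paired with the value of the deficiency delta(n) (rounded up).\<close>
definition rand_cond :: "nat \<Rightarrow> real \<Rightarrow> nat" where
  "rand_cond n d = prod_encode (n, nat \<lceil>d\<rceil>)"

definition delta_random :: "recf \<Rightarrow> (nat \<Rightarrow> real) \<Rightarrow> nat \<Rightarrow> (nat \<Rightarrow> nat \<Rightarrow> bool) \<Rightarrow> bool" where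
  "delta_random U \<delta> n E \<longleftrightarrow>
     real (KC U (edge_code n E) (rand_cond n (\<delta> n))) \<ge> real (n * (n - 1) div 2) - \<delta> n"

definition is_path :: "(nat \<Rightarrow> nat \<Rightarrow> bool) \<Rightarrow> nat list \<Rightarrow> bool" where
  "is_path E ps \<longleftrightarrow> ps \<noteq> [] \<and> (\<forall>i. Suc i < length ps \<longrightarrow> E (ps ! i) (ps ! Suc i))"

definition gdist :: "(nat \<Rightarrow> nat \<Rightarrow> bool) \<Rightarrow> nat \<Rightarrow> nat \<Rightarrow> nat" where
  "gdist E u v = (LEAST k. \<exists>ps. is_path E ps \<and> hd ps = u \<and> last ps = v \<and> length ps = Suc k)"

text \<open>R u v is the edge (identified with the neighbour it leads to) chosen at u for destination v.
  The route from u to v follows these choices; its length is the first time it hits v.\<close>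
definition route_reaches :: "(nat \<Rightarrow> nat \<Rightarrow> nat) \<Rightarrow> nat \<Rightarrow> nat \<Rightarrow> bool" where
  "route_reaches R u v \<longleftrightarrow> (\<exists>k. ((\<lambda>x. R x v) ^^ k) u = v)"

definition route_length :: "(nat \<Rightarrow> nat \<Rightarrow> nat) \<Rightarrow> nat \<Rightarrow> nat \<Rightarrow> nat" where
  "route_length R u v = (LEAST k. ((\<lambda>x. R x v) ^^ k) u = v)"

definition routing_scheme :: "nat \<Rightarrow> (nat \<Rightarrow> nat \<Rightarrow> bool) \<Rightarrow> (nat \<Rightarrow> nat \<Rightarrow> nat) \<Rightarrow> bool" where
  "routing_scheme n E R \<longleftrightarrow> (\<forall>u\<in>{1..n}. \<forall>v\<in>{1..n}. u \<noteq> v \<longrightarrow> E u (R u v))"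

definition stretch_at_most :: "nat \<Rightarrow> (nat \<Rightarrow> nat \<Rightarrow> bool) \<Rightarrow> (nat \<Rightarrow> nat \<Rightarrow> nat) \<Rightarrow> real \<Rightarrow> bool" where
  "stretch_at_most n E R s \<longleftrightarrow>
     (\<forall>u\<in>{1..n}. \<forall>v\<in>{1..n}. u \<noteq> v \<longrightarrow>
        route_reaches R u v \<and> real (route_length R u v) \<le> s * real (gdist E u v))"

text \<open>Model II: node u knows for free n, its own label and its neighbours (as the bit vector
  of adjacencies to 1..n). The local routing function at u is stored in the bit string b u
  if a fixed decoder (a partial recursive function Dec) recovers R u v from this free
  information, b u, and the destination v.\<close>
definition nbr_vec :: "nat \<Rightarrow> (nat \<Rightarrow> nat \<Rightarrow> bool) \<Rightarrow> nat \<Rightarrow> bool list" where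
  "nbr_vec n E u = map (\<lambda>w. E u w) [1..<Suc n]"

definition stored_by :: "recf \<Rightarrow> nat \<Rightarrow> (nat \<Rightarrow> nat \<Rightarrow> bool) \<Rightarrow> (nat \<Rightarrow> nat \<Rightarrow> nat) \<Rightarrow> (nat \<Rightarrow> bool list) \<Rightarrow> bool" where
  "stored_by Dec n E R b \<longleftrightarrow>
     (\<forall>u\<in>{1..n}. \<forall>v\<in>{1..n}. u \<noteq> v \<longrightarrow>
        eval Dec [n, u, code (nbr_vec n E u), code (b u), v] (R u v))"

end

(* Let atypical graphs be those where some vertex has no neighbour among the first
m = ceil (c log n) + 2 floor (log n) vertices, where some two vertices have no common neighbour, or where
some unary relay table (see hops below) exceeds 3n bits. Atypicality is decidable and, by a
union bound, has probability O(n^(-c-1)); the exponential moment E[(3/2)^length] <= 3^n handles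
the tables. Hence the index of an atypical graph among all atypical graphs is a program which is
too short for a (c log n)-random graph.
In a typical graph let B be the first m vertices. A vertex outside B sends everything it cannot
deliver directly to its least neighbour, which lies in B and is part of the free information,
so nothing is stored. A vertex of B stores, for every destination, the rank of the first common
neighbour among its own neighbours. Routes to vertices at distance 2 thus have length at most 3. *)

theory Submission
  imports Defs "HOL-Library.Disjoint_Sets" "HOL-Real_Asymp.Real_Asymp"
begin

section \<open>Computable functions and decidable predicates\<close>

text \<open>An index among a fraction eps of all graphs saves log(1/eps) bits, and this must exceed
  the deficiency c log n plus the unknown constant of the universal machine, so eps has to be
  o(n^(-c)). This fixes m: a given vertex misses the first m vertices with probability 2^(-m), one
  floor(log n) pays for the union over n vertices, and the other gives a margin of order 1/n that
  beats the constant. An arbitrary real c need not be computable. Decidability survives because the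
  complexity is conditional on n and ceil(c log n), and atypicality depends on c only through this
  number. The first common neighbour of b and v is preceded by a geometric number of neighbours of
  b, so a unary entry has about 2 bits on average. Its moment to base 3/2 is at most 3, and 3 <
  (3/2)^3 makes tables beyond 3n bits exponentially rare. Decoder and atypicality test must both be
  recursive functions in the bare sense of \<open>eval\<close>; hence both are built from bounded
  sums and quantifiers over numbers.\<close>

definition env :: "nat list \<Rightarrow> nat \<Rightarrow> nat" where
  "env e i = (if i < length e then e ! i else 0)"

lemma env_Cons [simp]: "env (x # e) 0 = x" "env (x # e) (Suc i) = env e i"
  by (simp_all add: env_def)

lemma env_tl [simp]: "env (tl e) i = env e (Suc i)"
  by (cases e) (simp_all add: env_def)

lemma map_env: "length e = k \<Longrightarrow> map (env e) [0..<k] = e"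
  by (auto simp: env_def intro: nth_equalityI)

definition computable :: "nat \<Rightarrow> (nat list \<Rightarrow> nat) \<Rightarrow> bool" where
  "computable k F \<longleftrightarrow> (\<exists>r. \<forall>e. length e = k \<longrightarrow> eval r e (F e))"

lemma computable_cong:
  assumes "computable k F" and "\<And>e. length e = k \<Longrightarrow> F e = G e"
  shows "computable k G"
  using assms unfolding computable_def by metis

text \<open>The default 0 outside the list frees this introduction rule from any side condition on
  \<open>i\<close>.\<close>

lemma computable_env: "computable k (\<lambda>e. env e i)"
proof (cases "i < k")
  case True
  then show ?thesis
    unfolding computable_def env_def by (intro exI[of _ "Proj i"]) (auto intro: evProj)
next
  case False
  then show ?thesis
    unfolding computable_def env_def by (intro exI[of _ Z]) (auto intro: evZ)
qed

lemma computable_comp: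
  assumes "computable (length Fs) G" and "\<And>F. F \<in> set Fs \<Longrightarrow> computable k F"
  shows "computable k (\<lambda>e. G (map (\<lambda>F. F e) Fs))"
proof -
  obtain g where g: "\<And>e. length e = length Fs \<Longrightarrow> eval g e (G e)"
    using assms(1) unfolding computable_def by blast
  have "\<forall>F\<in>set Fs. \<exists>r. \<forall>e. length e = k \<longrightarrow> eval r e (F e)"
    using assms(2) unfolding computable_def by blast
  then obtain \<rho> where \<rho>: "\<And>F e. F \<in> set Fs \<Longrightarrow> length e = k \<Longrightarrow> eval (\<rho> F) e (F e)"
    by metis
  have "eval (Cn g (map \<rho> Fs)) e (G (map (\<lambda>F. F e) Fs))" if "length e = k" for e
  proof (rule evCn)
    show "list_all2 (\<lambda>g y. eval g e y) (map \<rho> Fs) (map (\<lambda>F. F e) Fs)"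
      using \<rho> that by (auto simp: list_all2_conv_all_nth)
  qed (simp add: g)
  then show ?thesis
    unfolding computable_def by blast
qed

lemma computable_unary:
  assumes "computable 1 (\<lambda>e. f (env e 0))" and "computable k F0"
  shows "computable k (\<lambda>e. f (F0 e))"
  using computable_comp[of "[F0]" "\<lambda>e. f (env e 0)" k] assms by auto

lemma computable_binary:
  assumes "computable 2 (\<lambda>e. f (env e 0) (env e 1))" and "computable k F0" "computable k F1"
  shows "computable k (\<lambda>e. f (F0 e) (F1 e))"
  using computable_comp[of "[F0, F1]" "\<lambda>e. f (env e 0) (env e 1)" k] assms
  by (auto simp: numeral_2_eq_2)

lemma computable_quaternary:
  assumes "computable 4 (\<lambda>e. f (env e 0) (env e 1) (env e 2) (env e 3))"
    and "computable k F0" "computable k F1" "computable k F2" "computable k F3"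
  shows "computable k (\<lambda>e. f (F0 e) (F1 e) (F2 e) (F3 e))"
  using computable_comp[of "[F0, F1, F2, F3]" "\<lambda>e. f (env e 0) (env e 1) (env e 2) (env e 3)" k] assms
  by (auto simp: eval_nat_numeral)

lemma computable_Suc:
  assumes "computable k F"
  shows "computable k (\<lambda>e. Suc (F e))"
proof -
  have "eval S e (Suc (env e 0))" if "length e = 1" for e
    using that evS[of "hd e" "tl e"] by (cases e) auto
  then have "computable 1 (\<lambda>e. Suc (env e 0))"
    unfolding computable_def by blast
  then show ?thesis
    using assms by (rule computable_unary)
qed

lemma computable_const: "computable k (\<lambda>e. c)"
proof (induction c)
  case 0
  show ?case
    unfolding computable_def by (blast intro: evZ)
next
  case (Suc c)
  then show ?case by (rule computable_Suc)
qed

lemma computable_rec_nat: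
  assumes "computable k f" and "computable (Suc (Suc k)) g"
  shows "computable (Suc k) (\<lambda>e. rec_nat (f (tl e)) (\<lambda>i y. g (i # y # tl e)) (env e 0))"
proof -
  obtain rf rg where rf: "\<And>e. length e = k \<Longrightarrow> eval rf e (f e)"
    and rg: "\<And>e. length e = Suc (Suc k) \<Longrightarrow> eval rg e (g e)"
    using assms unfolding computable_def by blast
  have "eval (Pr rf rg) (a # e) (rec_nat (f e) (\<lambda>i y. g (i # y # e)) a)" if "length e = k" for a e
  proof (induction a)
    case 0
    show ?case using rf that by (simp add: evPr0)
  next
    case (Suc a)
    show ?case
      using evPrS[OF Suc, of "g (a # rec_nat (f e) (\<lambda>i y. g (i # y # e)) a # e)"] rg that by simp
  qed
  then have "eval (Pr rf rg) e (rec_nat (f (tl e)) (\<lambda>i y. g (i # y # tl e)) (env e 0))"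
    if "length e = Suc k" for e
    using that by (cases e) auto
  then show ?thesis
    unfolding computable_def by blast
qed

text \<open>\<open>Pr\<close> takes its counter as first argument. Composing with \<open>b\<close>
  followed by all projections supplies a computed counter and keeps the whole environment as
  parameters.\<close>

lemma computable_rec:
  assumes f: "computable k f"
    and g: "computable (Suc (Suc k)) (\<lambda>e. g (env e 0) (env e 1) (tl (tl e)))"
    and b: "computable k b"
  shows "computable k (\<lambda>e. rec_nat (f e) (\<lambda>i y. g i y e) (b e))"
proof -
  let ?R = "\<lambda>e. rec_nat (f (tl e)) (\<lambda>i y. g i y (tl e)) (env e 0)"
  let ?Fs = "b # map (\<lambda>i e. env e i) [0..<k]"
  have "computable (length ?Fs) ?R"
    using computable_rec_nat[OF f g] by simp
  then have "computable k (\<lambda>e. ?R (map (\<lambda>F. F e) ?Fs))"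
    by (rule computable_comp) (auto intro: b computable_env)
  then show ?thesis
    by (rule computable_cong) (simp add: comp_def map_env)
qed

text \<open>Argument 1 of a recursion step is the accumulated value. A summand must not see it, so
  it is projected away.\<close>

lemma computable_skip:
  assumes "computable (Suc k) (\<lambda>e. g (env e 0) (tl e))"
  shows "computable (Suc (Suc k)) (\<lambda>e. g (env e 0) (tl (tl e)))"
proof -
  let ?Fs = "(\<lambda>e. env e 0) # map (\<lambda>i e. env e (i + 2)) [0..<k]"
  have "computable (length ?Fs) (\<lambda>e. g (env e 0) (tl e))"
    using assms by simp
  then have "computable (Suc (Suc k)) (\<lambda>e. (\<lambda>e. g (env e 0) (tl e)) (map (\<lambda>F. F e) ?Fs))"
    by (rule computable_comp) (auto intro: computable_env)
  then show ?thesis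
  proof (rule computable_cong)
    fix e :: "nat list"
    assume "length e = Suc (Suc k)"
    then have "map (\<lambda>i. env e (i + 2)) [0..<k] = tl (tl e)"
      by (auto simp: env_def nth_tl intro: nth_equalityI)
    then show "g (env (map (\<lambda>F. F e) ?Fs) 0) (tl (map (\<lambda>F. F e) ?Fs)) = g (env e 0) (tl (tl e))"
      by (simp add: comp_def)
  qed
qed

lemma computable_add:
  assumes "computable k F" "computable k G"
  shows "computable k (\<lambda>e. F e + G e)"
proof -
  have *: "rec_nat a (\<lambda>i y. Suc y) b = a + b" for a b :: nat
    by (induction b) auto
  show ?thesis
    using computable_rec[OF assms(1) _ assms(2), of "\<lambda>i y e. Suc y"]
    by (simp add: * computable_Suc computable_env)
qed

lemma computable_pred:
  assumes "computable k F"
  shows "computable k (\<lambda>e. F e - 1)"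
proof -
  have *: "rec_nat 0 (\<lambda>i y. i) b = b - 1" for b :: nat
    by (induction b) auto
  show ?thesis
    using computable_rec[OF computable_const _ assms, of "\<lambda>i y e. i" 0]
    by (simp add: * computable_env)
qed

lemma computable_diff:
  assumes "computable k F" "computable k G"
  shows "computable k (\<lambda>e. F e - G e)"
proof -
  have *: "rec_nat a (\<lambda>i y. y - 1) b = a - b" for a b :: nat
    by (induction b) auto
  have "computable (Suc (Suc k)) (\<lambda>e. env e 1 - 1)"
    by (intro computable_pred computable_env)
  then show ?thesis
    using computable_rec[OF assms(1) _ assms(2), of "\<lambda>i y e. y - 1"] by (simp only: *)
qed

lemma computable_sum:
  assumes "computable (Suc k) (\<lambda>e. g (env e 0) (tl e))" and "computable k b"
  shows "computable k (\<lambda>e. \<Sum>i<b e. g i e)"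
proof -
  have *: "rec_nat 0 (\<lambda>i y. y + h i) c = sum h {..<c}" for h :: "nat \<Rightarrow> nat" and c
    by (induction c) auto
  have "computable (Suc (Suc k)) (\<lambda>e. env e 1 + g (env e 0) (tl (tl e)))"
    by (intro computable_add computable_env computable_skip assms)
  then show ?thesis
    using computable_rec[OF computable_const _ assms(2), of "\<lambda>i y e. y + g i e" 0] by (simp only: *)
qed

lemma computable_mult:
  assumes "computable k F" "computable k G"
  shows "computable k (\<lambda>e. F e * G e)"
proof -
  have "computable 2 (\<lambda>e. \<Sum>i<env e 0. env e 1)"
    using computable_sum[of 2 "\<lambda>i e. env e 1" "\<lambda>e. env e 0"]
    by (simp add: computable_env)
  then have "computable 2 (\<lambda>e. env e 0 * env e 1)"
    by simp
  then show ?thesis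
    using assms by (rule computable_binary)
qed

lemma computable_power2:
  assumes "computable k F"
  shows "computable k (\<lambda>e. 2 ^ F e)"
proof -
  have *: "rec_nat (1 :: nat) (\<lambda>i y. y + y) b = 2 ^ b" for b
    by (induction b) auto
  have "computable (Suc (Suc k)) (\<lambda>e. env e 1 + env e 1)"
    by (intro computable_add computable_env)
  then show ?thesis
    using computable_rec[OF computable_const _ assms, of "\<lambda>i y e. y + y" 1] by (simp only: *)
qed

section \<open>Decidable predicates: connectives, bounded quantifiers, bits and enumeration\<close>

abbreviation decidable :: "nat \<Rightarrow> (nat list \<Rightarrow> bool) \<Rightarrow> bool" where
  "decidable k P \<equiv> computable k (\<lambda>e. of_bool (P e))"

lemma decidable_le:
  assumes "computable k F" "computable k G"
  shows "decidable k (\<lambda>e. F e \<le> G e)"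
proof -
  have "computable k (\<lambda>e. 1 - (F e - G e))"
    by (intro computable_diff computable_const assms)
  then show ?thesis
    by (rule computable_cong) (simp add: of_bool_def)
qed

lemma decidable_less:
  assumes "computable k F" "computable k G"
  shows "decidable k (\<lambda>e. F e < G e)"
  using decidable_le[OF computable_Suc[OF assms(1)] assms(2)] by (simp add: Suc_le_eq)

lemma decidable_conj:
  assumes "decidable k P" "decidable k Q"
  shows "decidable k (\<lambda>e. P e \<and> Q e)"
  using computable_mult[OF assms] by (simp add: of_bool_conj)

lemma decidable_not:
  assumes "decidable k P"
  shows "decidable k (\<lambda>e. \<not> P e)"
proof -
  have "computable k (\<lambda>e. 1 - of_bool (P e))"
    by (intro computable_diff computable_const assms)
  then show ?thesis
    by (rule computable_cong) simp
qed

lemma decidable_disj: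
  assumes "decidable k P" "decidable k Q"
  shows "decidable k (\<lambda>e. P e \<or> Q e)"
  using decidable_not[OF decidable_conj[OF decidable_not[OF assms(1)] decidable_not[OF assms(2)]]]
  by simp

lemma decidable_eq:
  assumes "computable k F" "computable k G"
  shows "decidable k (\<lambda>e. F e = G e)"
  using decidable_conj[OF decidable_le[OF assms] decidable_le[OF assms(2,1)]]
  by (simp add: order_eq_iff)

lemma decidable_all:
  assumes "decidable (Suc k) (\<lambda>e. P (env e 0) (tl e))" "computable k b"
  shows "decidable k (\<lambda>e. \<forall>i<b e. P i e)"
proof -
  have "decidable k (\<lambda>e. (\<Sum>i<b e. of_bool (\<not> P i e)) = (0 :: nat))"
    by (intro decidable_eq computable_sum computable_const decidable_not assms)
  then show ?thesis
    by (rule computable_cong) auto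
qed

lemma decidable_ex:
  assumes "decidable (Suc k) (\<lambda>e. P (env e 0) (tl e))" "computable k b"
  shows "decidable k (\<lambda>e. \<exists>i<b e. P i e)"
  using decidable_not[OF decidable_all[OF decidable_not[OF assms(1)] assms(2)]] by simp

lemma computable_if:
  assumes "decidable k P" "computable k F" "computable k G"
  shows "computable k (\<lambda>e. if P e then F e else G e)"
proof -
  have "computable k (\<lambda>e. of_bool (P e) * F e + of_bool (\<not> P e) * G e)"
    by (intro computable_add computable_mult decidable_not assms)
  then show ?thesis
    by (rule computable_cong) auto
qed

text \<open>For \<open>b > 0\<close> the quotient is the number of \<open>i < a\<close> with
  \<open>Suc i * b \<le> a\<close>, a bounded sum of a decidable predicate.\<close>

lemma computable_div:
  assumes "computable k F" "computable k G"
  shows "computable k (\<lambda>e. F e div G e)"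
proof -
  have "a div b = (if b = 0 then 0 else \<Sum>i<a. of_bool (Suc i * b \<le> a))" for a b :: nat
  proof (cases "b = 0")
    case False
    have "{..<a} \<inter> {i. Suc i * b \<le> a} = {..<a div b}"
    proof (intro set_eqI)
      fix i
      have "Suc i * b \<le> a \<longleftrightarrow> i < a div b"
        using False by (metis Suc_le_eq less_eq_div_iff_mult_less_eq neq0_conv)
      moreover have "a div b \<le> a" by simp
      ultimately show "i \<in> {..<a} \<inter> {i. Suc i * b \<le> a} \<longleftrightarrow> i \<in> {..<a div b}"
        by (auto simp del: mult_Suc div_le_dividend)
    qed
    with False show ?thesis
      by (simp add: sum.If_cases of_bool_def del: mult_Suc)
  qed simp
  then have *: "computable 2 (\<lambda>e. env e 0 div env e 1) \<longleftrightarrow>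
      computable 2 (\<lambda>e. if env e 1 = 0 then 0
        else \<Sum>i<env e 0. of_bool (Suc i * env e 1 \<le> env e 0))"
    by presburger
  show ?thesis
    by (rule computable_binary[OF _ assms], subst *)
      (intro computable_if decidable_eq decidable_le computable_sum computable_mult computable_Suc
        computable_env computable_const, simp_all add: computable_env)
qed

lemmas computable_intros =
  computable_env computable_const computable_Suc computable_add computable_diff computable_mult
  computable_div computable_power2 computable_sum computable_if
  decidable_le decidable_less decidable_eq decidable_conj decidable_disj decidable_not
  decidable_all decidable_ex

lemma decidable_bit:
  assumes "computable k F" "computable k G"
  shows "decidable k (\<lambda>e. bit (F e) (G e))"
proof -
  \<comment> \<open>A number q is odd iff q = 2 (q div 2) + 1, which only uses operations already
    shown computable.\<close>
  have *: "bit a n \<longleftrightarrow> a div 2 ^ n = Suc (2 * (a div 2 ^ n div 2))" for a n :: nat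
    unfolding bit_iff_odd by (metis odd_two_times_div_two_succ even_Suc even_mult_iff even_numeral Suc_eq_plus1)
  show ?thesis
    unfolding * by (intro computable_intros assms)
qed

lemma computable_triangle:
  assumes "computable k F"
  shows "computable k (\<lambda>e. triangle (F e))"
  unfolding triangle_def by (intro computable_intros assms)

lemma computable_prod_encode:
  assumes "computable k F" "computable k G"
  shows "computable k (\<lambda>e. prod_encode (F e, G e))"
  unfolding prod_encode_def by (simp, intro computable_intros computable_triangle assms)

text \<open>Unbounded search for a solution with the given number of smaller solutions. The
  solutions below \<open>z\<close> have strictly smaller counts, so the search stops at
  \<open>z\<close>.\<close>

lemma computable_nth_element:
  assumes "decidable 2 (\<lambda>e. P (env e 0) (env e 1))"
  shows "\<exists>f. \<forall>y z. P y z \<longrightarrow> eval f [card {i. i < z \<and> P y i}, y] z"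
proof -
  have P: "decidable k (\<lambda>e. P (F e) (G e))" if "computable k F" "computable k G" for k F G
    using assms that by (rule computable_binary)
  let ?Q = "\<lambda>z j y. P y z \<and> (\<Sum>i<z. of_bool (P y i)) = j"
  have "decidable 3 (\<lambda>e. \<not> ?Q (env e 0) (env e 1) (env e 2))"
    by (intro computable_intros P) (simp_all add: computable_env)
  then obtain g where "\<And>e. length e = 3 \<Longrightarrow> eval g e (of_bool (\<not> ?Q (env e 0) (env e 1) (env e 2)))"
    unfolding computable_def by blast
  from this[of "[_, _, _]"] have g: "eval g [z, j, y] (of_bool (\<not> ?Q z j y))" for z j y
    by (simp add: eval_nat_numeral)
  have cnt: "(\<Sum>i<z. of_bool (P y i)) = card {i. i < z \<and> P y i}" for y z
    by (simp add: of_bool_def sum.If_cases lessThan_def Collect_conj_eq)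
  have "eval (Mn g) [card {i. i < z \<and> P y i}, y] z" if "P y z" for y z
  proof (rule evMn)
    show "eval g [z, card {i. i < z \<and> P y i}, y] 0"
      using g[of z "card {i. i < z \<and> P y i}" y] that by (simp add: cnt)
    show "\<forall>x<z. \<exists>m>0. eval g [x, card {i. i < z \<and> P y i}, y] m"
    proof (intro allI impI)
      fix x assume "x < z"
      have "card {i. i < x \<and> P y i} < card {i. i < z \<and> P y i}" if "P y x"
        using that \<open>x < z\<close> by (intro psubset_card_mono) auto
      then have "\<not> ?Q x (card {i. i < z \<and> P y i}) y"
        by (auto simp: cnt)
      then show "\<exists>m>0. eval g [x, card {i. i < z \<and> P y i}, y] m"
        using g[of x "card {i. i < z \<and> P y i}" y] by auto
    qed
  qed
  then show ?thesis by blast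
qed

section \<open>Binary codes and short programs\<close>

lemma bin_val_bounds: "2 ^ length ys \<le> bin_val ys \<and> bin_val ys < 2 ^ Suc (length ys)"
  by (induction ys) auto

lemma bin_val_surj: "X > 0 \<Longrightarrow> \<exists>ys. bin_val ys = X"
proof (induction X rule: less_induct)
  case (less X)
  show ?case
  proof (cases "X = 1")
    case True
    then show ?thesis by (intro exI[of _ "[]"]) simp
  next
    case False
    with less have "X div 2 < X" "X div 2 > 0" by auto
    with less obtain ys where "bin_val ys = X div 2" by blast
    then show ?thesis by (intro exI[of _ "odd X # ys"]) auto
  qed
qed

lemma bit_bin_val: "bit (bin_val ys) j \<longleftrightarrow> (if j < length ys then ys ! j else j = length ys)"
proof (induction ys arbitrary: j)
  case Nil
  show ?case by (cases j) (simp_all add: bit_0 bit_Suc)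
next
  case (Cons y ys)
  then show ?case by (cases j) (simp_all add: bit_0 bit_Suc)
qed

text \<open>The bits of \<open>Suc (code w)\<close> are those of \<open>w\<close>, the last one
  lowest, topped by a marker 1.\<close>

lemma Suc_code: "Suc (code w) = bin_val (rev w)"
proof -
  have "bin_val (rev w) > 0"
    using bin_val_bounds[of "rev w"] by (metis gr0I not_less power_eq_0_iff le_zero_eq zero_neq_numeral)
  then show ?thesis by (simp add: code_def)
qed

lemma code_surj: "\<exists>w. code w = k"
proof -
  obtain ys where "bin_val ys = Suc k" using bin_val_surj by blast
  then have "Suc (code (rev ys)) = Suc k" by (simp add: Suc_code)
  then show ?thesis by blast
qed

lemma power_length_le_code: "2 ^ length w \<le> Suc (code w)"
  using bin_val_bounds[of "rev w"] by (simp add: Suc_code)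

text \<open>The program is the index of \<open>x\<close> within its class, written in binary;
  universality adds a constant that does not depend on the condition \<open>y\<close>.\<close>

lemma KC_le_card:
  assumes "universal U" and "decidable 2 (\<lambda>e. P (env e 0) (env e 1))"
  shows "\<exists>c. \<forall>x y. P y (code x) \<longrightarrow> finite {z. P y z} \<longrightarrow>
           2 ^ KC U x y \<le> (2 ^ c * card {z. P y z} :: nat)"
proof -
  obtain f where f: "\<And>y z. P y z \<Longrightarrow> eval f [card {i. i < z \<and> P y i}, y] z"
    using computable_nth_element[OF assms(2)] by blast
  obtain c where c: "\<And>p y x. eval f [code p, y] x \<Longrightarrow>
      \<exists>q. eval U [code q, y] x \<and> length q \<le> length p + c"
    using assms(1) unfolding universal_def by blast
  have "2 ^ KC U x y \<le> (2 ^ c * card {z. P y z} :: nat)"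
    if P: "P y (code x)" and fin: "finite {z. P y z}" for x y
  proof -
    let ?k = "card {i. i < code x \<and> P y i}"
    obtain p where p: "code p = ?k" using code_surj by blast
    then obtain q where q: "eval U [code q, y] (code x)" "length q \<le> length p + c"
      using c f[OF P] by metis
    have "KC U x y \<le> length q"
      unfolding KC_def using q(1) by (intro Least_le) blast
    then have "2 ^ KC U x y \<le> (2 ^ (length p + c) :: nat)"
      using q(2) by (intro power_increasing) auto
    also have "\<dots> \<le> 2 ^ c * Suc ?k"
      using mult_le_mono2[OF power_length_le_code[of p], of "2 ^ c"] p
      by (simp add: power_add mult.commute)
    \<comment> \<open>The string itself is not among the elements below its code; the strict
      inequality absorbs the \<open>Suc\<close>.\<close>
    also have "?k < card {z. P y z}"
      using P fin by (intro psubset_card_mono) auto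
    then have "2 ^ c * Suc ?k \<le> 2 ^ c * card {z. P y z}"
      by (intro mult_left_mono) auto
    finally show ?thesis .
  qed
  then show ?thesis by blast
qed

text \<open>Counting columns from the right makes the position of an edge from the end of the
  lexicographic order a value of the standard pairing function.\<close>
definition edge_pos :: "nat \<Rightarrow> nat \<Rightarrow> nat \<Rightarrow> nat" where
  "edge_pos n i j = prod_encode (n - Suc (max i j), max i j - Suc (min i j))"

text \<open>Taking a set lets one definition serve the decision procedure, via \<open>bits\<close>,
  and the counting, where the edge set is a random subset.\<close>

definition graph_of :: "nat \<Rightarrow> nat set \<Rightarrow> nat \<Rightarrow> nat \<Rightarrow> bool" where
  "graph_of n A i j \<longleftrightarrow> i < n \<and> j < n \<and> i \<noteq> j \<and> edge_pos n i j \<in> A"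

abbreviation bits :: "nat \<Rightarrow> nat set" where
  "bits X \<equiv> {j. bit X j}"

text \<open>The last \<open>i\<close> rows of the upper triangle have lengths i-1, ..., 1, 0 and
  come first after reversal, so offsets from the end are triangular numbers.\<close>

lemma edge_rows:
  fixes n :: nat and E :: "nat \<Rightarrow> nat \<Rightarrow> bool"
  defines "rows \<equiv> \<lambda>i. concat (map (\<lambda>i. map (E i) [Suc i..<Suc n]) [i..<Suc n])"
  shows "i \<le> n \<Longrightarrow> length (rows (n - i + 1)) = triangle (i - 1)"
    and "i \<le> n \<Longrightarrow> \<exists>zs. rev (rows 1) = rev (rows (n - i + 1)) @ zs"
proof -
  have row: "rows i = map (E i) [Suc i..<Suc n] @ rows (Suc i)" if "i \<le> n" for i
    using that by (simp add: rows_def upt_conv_Cons del: upt_Suc)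
  show "length (rows (n - i + 1)) = triangle (i - 1)" if "i \<le> n"
    using that
  proof (induction i)
    case 0
    then show ?case by (simp add: rows_def)
  next
    case (Suc i)
    then have "rows (n - Suc i + 1) = map (E (n - i)) [Suc (n - i)..<Suc n] @ rows (n - i + 1)"
      using row[of "n - i"] by (simp add: Suc_diff_Suc)
    then show ?case using Suc by (cases i) (simp_all add: Suc_diff_le)
  qed
  show "\<exists>zs. rev (rows 1) = rev (rows (n - i + 1)) @ zs" if "i \<le> n"
    using that
  proof (induction "n - i" arbitrary: i)
    case 0
    then show ?case by simp
  next
    case (Suc k)
    then have "k = n - Suc i" "Suc i \<le> n" by auto
    with Suc obtain zs where "rev (rows 1) = rev (rows (n - Suc i + 1)) @ zs" by blast
    moreover have "rows (n - Suc i + 1) = map (E (n - i)) [Suc (n - i)..<Suc n] @ rows (n - i + 1)"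
      using row[of "n - i"] \<open>Suc i \<le> n\<close> by (simp add: Suc_diff_Suc)
    ultimately show ?case by simp
  qed
qed

lemma edge_code_rows:
  "edge_code n E = concat (map (\<lambda>i. map (E i) [Suc i..<Suc n]) [1..<Suc n])"
  by (simp add: edge_code_def)

lemma length_edge_code: "length (edge_code n E) = triangle (n - 1)"
proof (cases n)
  case (Suc m)
  with edge_rows(1)[of n n E] show ?thesis by (simp only: edge_code_rows) simp
qed (simp add: edge_code_def)

lemma nth_rev_edge_code:
  assumes "i < j" "j < n"
  shows "prod_encode (n - Suc j, j - Suc i) < length (edge_code n E)"
    and "rev (edge_code n E) ! prod_encode (n - Suc j, j - Suc i) = E (Suc i) (Suc j)"
proof -
  let ?rows = "\<lambda>i. concat (map (\<lambda>i. map (E i) [Suc i..<Suc n]) [i..<Suc n])"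
  let ?k = "n - Suc i"
  have row: "?rows (Suc i) = map (E (Suc i)) [Suc (Suc i)..<Suc n] @ ?rows (Suc (Suc i))"
    using assms by (simp add: upt_conv_Cons del: upt_Suc)
  have "n - ?k + 1 = Suc (Suc i)" "?k \<le> n" "n - Suc ?k + 1 = Suc i" "Suc ?k \<le> n"
    using assms by auto
  then have len: "length (?rows (Suc (Suc i))) = triangle (?k - 1)"
    and "\<exists>zs. rev (?rows 1) = rev (?rows (Suc i)) @ zs"
    using edge_rows(1)[of ?k n E] edge_rows(2)[of "Suc ?k" n E] by metis+
  then obtain zs where zs: "rev (edge_code n E) =
      rev (?rows (Suc (Suc i))) @ rev (map (E (Suc i)) [Suc (Suc i)..<Suc n]) @ zs"
    by (auto simp only: edge_code_rows row rev_append append_assoc)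
  \<comment> \<open>The two coordinates add up to \<open>?k - 1\<close>, so the pairing function
    contributes exactly the length of the later rows as offset.\<close>
  have pos: "prod_encode (n - Suc j, j - Suc i) = triangle (?k - 1) + (n - Suc j)"
    using assms by (simp add: prod_encode_def)
  have "length (rev (edge_code n E)) \<ge> triangle (?k - 1) + (n - Suc i)"
    unfolding zs using assms by (simp only: length_append length_rev len) simp
  then show "prod_encode (n - Suc j, j - Suc i) < length (edge_code n E)"
    using assms pos by simp
  have "n - Suc j < n - Suc i"
    using assms by simp
  then have "rev (edge_code n E) ! (triangle (?k - 1) + (n - Suc j)) =
      rev (map (E (Suc i)) [Suc (Suc i)..<Suc n]) ! (n - Suc j)"
    unfolding zs using \<open>n - Suc j < n - Suc i\<close> len by (simp add: nth_append del: upt_Suc)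
  also have "\<dots> = E (Suc i) (Suc j)"
    using assms by (simp add: rev_nth del: upt_Suc) (rule arg_cong[of _ _ "E (Suc i)"], arith)
  finally show "rev (edge_code n E) ! prod_encode (n - Suc j, j - Suc i) = E (Suc i) (Suc j)"
    using pos by simp
qed

abbreviation zero_based :: "nat \<Rightarrow> (nat \<Rightarrow> nat \<Rightarrow> bool) \<Rightarrow> nat \<Rightarrow> nat \<Rightarrow> bool" where
  "zero_based n E \<equiv> \<lambda>i j. i < n \<and> j < n \<and> E (Suc i) (Suc j)"

text \<open>All queried positions lie below the length of the string, so the marker bit is never
  mistaken for an edge.\<close>

lemma graph_of_edge_code:
  assumes "is_graph n E"
  shows "graph_of n (bits (Suc (code (edge_code n E)))) = zero_based n E"
proof (intro ext)
  fix i j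
  have *: "graph_of n (bits (Suc (code (edge_code n E)))) i j \<longleftrightarrow> E (Suc i) (Suc j)"
    if "i < j" "j < n" for i j
    using nth_rev_edge_code[OF that, of E] that
    by (simp add: graph_of_def edge_pos_def Suc_code bit_bin_val)
  have sym: "E u v \<longleftrightarrow> E v u" "\<not> E u u" for u v
    using assms(1) unfolding is_graph_def by blast+
  have comm: "edge_pos n i j = edge_pos n j i"
    by (simp add: edge_pos_def max.commute min.commute)
  consider "i < j" | "j < i" | "i = j" by linarith
  then show "graph_of n (bits (Suc (code (edge_code n E)))) i j \<longleftrightarrow>
      i < n \<and> j < n \<and> E (Suc i) (Suc j)"
    using *[of i j] *[of j i] sym(1)[of "Suc i" "Suc j"] sym(2) comm by cases (auto simp: graph_of_def)
qed

section \<open>Rank and selection among neighbours, unary tables\<close>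

definition rank :: "(nat \<Rightarrow> bool) \<Rightarrow> nat \<Rightarrow> nat" where
  "rank P w = (\<Sum>x<w. of_bool (P x))"

lemma rank_eq_card: "rank P w = card {x. x < w \<and> P x}"
  by (simp add: rank_def of_bool_def sum.If_cases lessThan_def Collect_conj_eq)

lemma rank_inj:
  assumes "P a" "P b" "rank P a = rank P b"
  shows "a = b"
proof -
  have "rank P a < rank P b" if "P a" "a < b" for a b
    unfolding rank_eq_card using that by (intro psubset_card_mono) auto
  then show ?thesis
    using assms by (metis linorder_neqE_nat less_irrefl)
qed

text \<open>Vertices are numbered from \<open>0\<close>, but the result is a label and these start at \<open>1\<close>.\<close>
definition select :: "nat \<Rightarrow> (nat \<Rightarrow> bool) \<Rightarrow> nat \<Rightarrow> nat" where
  "select n P r = (\<Sum>w<n. of_bool (P w \<and> rank P w = r) * Suc w)"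

lemma select_rank:
  assumes "x < n" "P x"
  shows "select n P (rank P x) = Suc x"
proof -
  have "select n P (rank P x) = (\<Sum>w<n. if w = x then Suc w else 0)"
    unfolding select_def using rank_inj[of P _ x] assms by (intro sum.cong) auto
  then show ?thesis using assms by simp
qed

lemma select_cong: "(\<And>w. w < n \<Longrightarrow> P w = Q w) \<Longrightarrow> select n P r = select n Q r"
  unfolding select_def rank_def by (intro sum.cong arg_cong2[where f = times] arg_cong[of _ _ of_bool]) auto

text \<open>On a number with binary digits \<open>0\<^sup>J 1 0\<^sup>K 1 \<dots>\<close>, least significant first, this decodes the
  \<open>r\<close>-th entry of \<open>J, K, \<dots>\<close>.\<close>
definition zeros_at_rank :: "nat \<Rightarrow> nat \<Rightarrow> nat \<Rightarrow> nat" where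
  "zeros_at_rank X L r = (\<Sum>j<L. of_bool (rank (bit X) j = r \<and> \<not> bit X j))"

text \<open>Dropping the lowest digit shifts all positions; a dropped 1 also lowers all ranks, and
  then no later digit had rank 0.\<close>

lemma zeros_at_rank_Cons:
  "zeros_at_rank (bin_val (y # ys)) (Suc L) r =
    (if y then if r = 0 then 0 else zeros_at_rank (bin_val ys) L (r - 1)
     else of_bool (r = 0) + zeros_at_rank (bin_val ys) L r)"
proof -
  have bits: "bit (bin_val (y # ys)) 0 = y" "bit (bin_val (y # ys)) (Suc j) = bit (bin_val ys) j" for j
    by (simp_all add: bit_0 bit_Suc)
  have rank: "rank (bit (bin_val (y # ys))) (Suc j) = of_bool y + rank (bit (bin_val ys)) j" for j
    unfolding rank_def sum.lessThan_Suc_shift bits by simp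
  have "rank P 0 = 0" for P
    by (simp add: rank_def)
  then show ?thesis
    unfolding zeros_at_rank_def sum.lessThan_Suc_shift bits rank by (cases r; cases y) simp_all
qed

definition unary :: "nat list \<Rightarrow> bool list" where
  "unary Js = concat (map (\<lambda>J. replicate J False @ [True]) Js)"

lemma length_unary: "length (unary Js) = (\<Sum>J\<leftarrow>Js. Suc J)"
  by (induction Js) (simp_all add: unary_def)

text \<open>The scan may overshoot: zeros above the marker have rank \<open>length Js + 1\<close>,
  beyond every valid \<open>r\<close>. The decoder can therefore use any upper bound on the
  length.\<close>

lemma zeros_at_rank_unary:
  assumes "r < length Js" "length (unary Js) \<le> L"
  shows "zeros_at_rank (bin_val (unary Js)) L r = Js ! r"
  using assms
proof (induction Js arbitrary: r L)
  case (Cons J Js)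
  have block: "zeros_at_rank (bin_val (replicate J False @ True # ys)) (J + Suc L) r =
      (if r = 0 then J else zeros_at_rank (bin_val ys) L (r - 1))" for J ys L
    by (induction J) (simp_all add: zeros_at_rank_Cons del: bin_val.simps)
  obtain L' where "L = J + Suc L'"
    using Cons.prems(2) by (auto simp: unary_def dest: le_Suc_ex)
  with Cons block[of J "unary Js" L'] show ?case
    by (cases r) (simp_all add: unary_def)
qed simp

text \<open>\<open>a\<close> is the code of the adjacency vector, \<open>t\<close> the code of the table. The empty table (\<open>t = 0\<close>)
  acts as a table whose entries are all \<open>0\<close>, that is, it selects the least neighbour.\<close>
definition route :: "nat \<Rightarrow> nat \<Rightarrow> nat \<Rightarrow> nat \<Rightarrow> nat" where
  "route n a t v = (if bit (Suc a) (n - v) then v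
     else select n (\<lambda>w. bit (Suc a) (n - Suc w)) (zeros_at_rank (Suc t) (Suc t) (v - 1)))"

lemma computable_route: "computable 5 (\<lambda>e. route (env e 0) (env e 2) (env e 3) (env e 4))"
  unfolding route_def select_def zeros_at_rank_def rank_def
  by (intro computable_intros decidable_bit) (simp_all add: computable_env decidable_bit computable_intros)

lemma bit_nbr_vec:
  assumes "w < n"
  shows "bit (Suc (code (nbr_vec n E u))) (n - Suc w) \<longleftrightarrow> E u (Suc w)"
  using assms by (simp add: Suc_code bit_bin_val nbr_vec_def rev_nth del: upt_Suc)

section \<open>Counting graphs\<close>

lemma of_bool_Ball:
  "finite I \<Longrightarrow> of_bool (\<forall>x\<in>I. P x) = (\<Prod>x\<in>I. of_bool (P x) :: real)"
  by (induction I rule: finite_induct) auto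

lemma card_eq_sum_of_bool:
  "finite F \<Longrightarrow> real (card {x \<in> F. P x}) = (\<Sum>x\<in>F. of_bool (P x))"
  by (simp add: of_bool_def flip: sum.inter_filter)

lemma card_union_bound:
  fixes c :: real
  assumes "finite I" "C \<subseteq> (\<Union>i\<in>I. U i)" "\<And>i. i \<in> I \<Longrightarrow> finite (U i)"
    and "\<And>i. i \<in> I \<Longrightarrow> real (card (U i)) \<le> c"
  shows "real (card C) \<le> real (card I) * c"
proof -
  have "card C \<le> card (\<Union>i\<in>I. U i)"
    using assms by (intro card_mono) auto
  also have "\<dots> \<le> (\<Sum>i\<in>I. card (U i))"
    using assms(1) by (rule card_UN_le)
  finally have "real (card C) \<le> (\<Sum>i\<in>I. real (card (U i)))"
    by (simp flip: of_nat_sum)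
  also have "\<dots> \<le> real (card I) * c"
    using assms(4) by (rule sum_bounded_above)
  finally show ?thesis .
qed

lemma sum_Pow_split:
  fixes F :: "'a set \<Rightarrow> real"
  assumes "finite W" "T \<subseteq> W"
  shows "(\<Sum>A\<in>Pow W. F A) = (\<Sum>C\<in>Pow T. \<Sum>D\<in>Pow (W - T). F (C \<union> D))"
proof -
  have "(\<Sum>C\<in>Pow T. \<Sum>D\<in>Pow (W - T). F (C \<union> D)) = (\<Sum>(C, D)\<in>Pow T \<times> Pow (W - T). F (C \<union> D))"
    using assms by (intro sum.cartesian_product)
  also have "\<dots> = (\<Sum>A\<in>Pow W. F A)"
    by (rule sum.reindex_bij_witness[where i = "\<lambda>A. (A \<inter> T, A - T)" and j = "\<lambda>(C, D). C \<union> D"])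
      (use assms in auto)
  finally show ?thesis by simp
qed

text \<open>For a uniformly random \<open>A\<close> the factors depend on disjoint blocks, hence are
  independent, and the mean of their product is at most the product of the bounds on their means.
  Multiplying by the number of subsets avoids probability spaces.\<close>

lemma sum_Pow_prod_le:
  fixes f :: "'i \<Rightarrow> 'a set \<Rightarrow> real" and r :: real
  assumes "finite I" "finite W" "r \<ge> 0"
    and "\<And>v. v \<in> I \<Longrightarrow> B v \<subseteq> W" "disjoint_family_on B I"
    and "\<And>v A. v \<in> I \<Longrightarrow> f v (A \<inter> B v) = f v A" "\<And>v A. f v A \<ge> 0"
    and "\<And>v. v \<in> I \<Longrightarrow> (\<Sum>A\<in>Pow (B v). f v A) \<le> r * 2 ^ card (B v)"
  shows "(\<Sum>A\<in>Pow W. \<Prod>v\<in>I. f v A) \<le> r ^ card I * 2 ^ card W"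
  using assms(1,2,4-)
proof (induction I arbitrary: W rule: finite_induct)
  case empty
  then show ?case by (simp add: card_Pow)
next
  case (insert v I)
  have sub: "B v \<subseteq> W" and fin: "finite (B v)"
    using insert.prems(1) insert.prems(2)[of v] by (auto intro: finite_subset)
  have disj: "B v \<inter> B w = {}" if "w \<in> I" for w
    using insert.prems(3) insert.hyps that by (auto simp: disjoint_family_on_def)
  have fv: "f v (C \<union> D) = f v C" if "D \<subseteq> W - B v" for C D
  proof -
    have "(C \<union> D) \<inter> B v = C \<inter> B v" using that by auto
    then show ?thesis using insert.prems(4)[of v] by (metis insertI1)
  qed
  have fw: "f w (C \<union> D) = f w D" if "C \<subseteq> B v" "w \<in> I" for C D w
  proof -
    have "(C \<union> D) \<inter> B w = D \<inter> B w" using that disj by auto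
    then show ?thesis using insert.prems(4)[of w] that by (metis insertI2)
  qed
  have "(\<Sum>A\<in>Pow W. \<Prod>v\<in>insert v I. f v A) =
      (\<Sum>C\<in>Pow (B v). \<Sum>D\<in>Pow (W - B v). \<Prod>v\<in>insert v I. f v (C \<union> D))"
    by (rule sum_Pow_split) (use insert.prems sub in auto)
  also have "\<dots> = (\<Sum>C\<in>Pow (B v). \<Sum>D\<in>Pow (W - B v). f v C * (\<Prod>v\<in>I. f v D))"
    using insert.hyps fv fw by (intro sum.cong refl) auto
  also have "\<dots> = (\<Sum>C\<in>Pow (B v). f v C) * (\<Sum>D\<in>Pow (W - B v). \<Prod>v\<in>I. f v D)"
    by (simp add: sum_product)
  also have "\<dots> \<le> (r * 2 ^ card (B v)) * (r ^ card I * 2 ^ card (W - B v))"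
  proof (intro mult_mono)
    show "(\<Sum>D\<in>Pow (W - B v). \<Prod>v\<in>I. f v D) \<le> r ^ card I * 2 ^ card (W - B v)"
    proof (rule insert.IH)
      show "B w \<subseteq> W - B v" if "w \<in> I" for w
        using insert.prems(2)[of w] disj[OF that] that by auto
      show "disjoint_family_on B I"
        using insert.prems(3) by (rule disjoint_family_on_mono[rotated]) auto
    qed (use insert.prems in auto)
  qed (use insert.prems assms(3) in \<open>auto intro!: sum_nonneg prod_nonneg\<close>)
  also have "\<dots> = r ^ card (insert v I) * 2 ^ card W"
  proof -
    have "card W = card (B v) + card (W - B v)"
      using insert.prems(1) sub fin by (simp add: card_Diff_subset card_mono)
    then show ?thesis using insert.hyps by (simp add: power_add)
  qed
  finally show ?case .
qed

text \<open>A truncated geometric variable \<open>G\<close> of parameter \<open>1/2\<close> satisfies \<open>E[(3/2)^G] \<le> 3\<close>.\<close>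
lemma sum_Pow_geometric_le:
  fixes M :: "nat set"
  assumes "finite M"
  shows "(\<Sum>A\<in>Pow M. (3 / 2) ^ Suc (card {x \<in> M. \<forall>y\<in>M. y \<le> x \<longrightarrow> y \<notin> A})) \<le> (3 :: real) * 2 ^ card M"
  using assms
proof (induction M rule: finite_linorder_min_induct)
  case (insert m M)
  let ?g = "\<lambda>M A. (3 / 2 :: real) ^ Suc (card {x \<in> M. \<forall>y\<in>M. y \<le> x \<longrightarrow> y \<notin> A})"
  have m: "m \<notin> M" using insert.hyps by blast
  \<comment> \<open>The new \<open>m\<close> lies below all of \<open>M\<close>: if it is in
    \<open>A\<close>, nothing is counted; otherwise the count grows by one.\<close>
  have with_m: "?g (insert m M) (insert m A) = 3 / 2" for A
  proof -
    have "{x \<in> insert m M. \<forall>y\<in>insert m M. y \<le> x \<longrightarrow> y \<notin> insert m A} = {}"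
      using insert.hyps by force
    then show ?thesis by (simp only: card.empty power_one_right flip: One_nat_def)
  qed
  have without_m: "?g (insert m M) A = 3 / 2 * ?g M A" if "A \<in> Pow M" for A
  proof -
    have "{x \<in> insert m M. \<forall>y\<in>insert m M. y \<le> x \<longrightarrow> y \<notin> A} =
        insert m {x \<in> M. \<forall>y\<in>M. y \<le> x \<longrightarrow> y \<notin> A}"
      using insert.hyps that by force
    then show ?thesis using insert.hyps(1) m by simp
  qed
  have "(\<Sum>A\<in>Pow (insert m M). ?g (insert m M) A) =
      (\<Sum>A\<in>Pow M. ?g (insert m M) A) + (\<Sum>A\<in>Pow M. ?g (insert m M) (insert m A))"
  proof -
    have "inj_on (insert m) (Pow M)" using m by (auto simp: inj_on_def)
    moreover have "Pow M \<inter> insert m ` Pow M = {}" using m by auto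
    ultimately show ?thesis
      unfolding Pow_insert using insert.hyps(1)
      by (subst sum.union_disjoint) (auto simp: sum.reindex)
  qed
  also have "(\<Sum>A\<in>Pow M. ?g (insert m M) (insert m A)) = 3 / 2 * 2 ^ card M"
    using insert.hyps(1) by (simp only: with_m) (simp add: card_Pow)
  also have "(\<Sum>A\<in>Pow M. ?g (insert m M) A) = 3 / 2 * (\<Sum>A\<in>Pow M. ?g M A)"
    by (simp only: without_m sum_distrib_left cong: sum.cong)
  \<comment> \<open>Averaging over the two cases maps a bound x to (3/2)(x + 1)/2, and 3 is the
    fixed point.\<close>
  also have "3 / 2 * (\<Sum>A\<in>Pow M. ?g M A) + 3 / 2 * 2 ^ card M \<le> 3 * 2 ^ card (insert m M)"
    using insert.IH insert.hyps(1) m by simp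
  finally show ?case .
qed simp

section \<open>Edges as independent coin flips, and the three atypical events\<close>

lemma edge_pos_eq_iff:
  assumes "i < n" "j < n" "k < n" "l < n" "i \<noteq> j" "k \<noteq> l"
  shows "edge_pos n i j = edge_pos n k l \<longleftrightarrow> i = k \<and> j = l \<or> i = l \<and> j = k"
proof
  assume "edge_pos n i j = edge_pos n k l"
  then have eqs: "n - Suc (max i j) = n - Suc (max k l)" "max i j - Suc (min i j) = max k l - Suc (min k l)"
    by (simp_all add: edge_pos_def)
  have "a = c \<and> b = d"
    if "n - Suc a = n - Suc c" "a - Suc b = c - Suc d" "a < n" "c < n" "b < a" "d < c" for a b c d
    using that by linarith
  from this[OF eqs] have "max i j = max k l" "min i j = min k l"
    using assms by (auto simp: max_def min_def)
  then show "i = k \<and> j = l \<or> i = l \<and> j = k"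
    by (auto simp: max_def min_def split: if_splits)
qed (auto simp: edge_pos_def max.commute min.commute)

lemma edge_pos_less:
  assumes "i < n" "j < n" "i \<noteq> j"
  shows "edge_pos n i j < triangle (n - 1)"
proof -
  define s where "s = n - Suc (min i j) - 1"
  have sum: "n - Suc (max i j) + (max i j - Suc (min i j)) = s"
    using assms unfolding s_def by linarith
  have "Suc s \<le> n - 1"
    using assms unfolding s_def by linarith
  moreover have "mono triangle"
    by (rule mono_iff_le_Suc[THEN iffD2]) simp
  ultimately have "triangle (Suc s) \<le> triangle (n - 1)"
    by (rule monoD[rotated])
  moreover have "edge_pos n i j < triangle (Suc s)"
    using sum unfolding edge_pos_def prod_encode_def by auto
  ultimately show ?thesis by linarith
qed

text \<open>For non-adjacent \<open>b\<close> and \<open>v\<close> this is the number of neighbours of \<open>b\<close> that precede their first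
  common neighbour: the entry for \<open>v\<close> in the routing table of \<open>b\<close>.\<close>
definition hops :: "nat \<Rightarrow> (nat \<Rightarrow> nat \<Rightarrow> bool) \<Rightarrow> nat \<Rightarrow> nat \<Rightarrow> nat" where
  "hops n g b v = (if b = v \<or> g b v then 0
     else \<Sum>x<n. of_bool (g b x \<and> (\<forall>y<Suc x. \<not> (g b y \<and> g y v))))"

definition uncovered :: "nat \<Rightarrow> nat \<Rightarrow> (nat \<Rightarrow> nat \<Rightarrow> bool) \<Rightarrow> bool" where
  "uncovered n m g \<longleftrightarrow> (\<exists>v<n. m \<le> v \<and> (\<forall>x<m. \<not> g x v))"

definition distant :: "nat \<Rightarrow> (nat \<Rightarrow> nat \<Rightarrow> bool) \<Rightarrow> bool" where
  "distant n g \<longleftrightarrow> (\<exists>b<n. \<exists>v<n. b \<noteq> v \<and> (\<forall>x<n. \<not> (g b x \<and> g x v)))"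

definition long_table :: "nat \<Rightarrow> (nat \<Rightarrow> nat \<Rightarrow> bool) \<Rightarrow> bool" where
  "long_table n g \<longleftrightarrow> (\<exists>b<n. 3 * n < (\<Sum>v<n. Suc (hops n g b v)))"

abbreviation edge_sets :: "nat \<Rightarrow> nat set set" where
  "edge_sets n \<equiv> Pow {..<triangle (n - 1)}"

text \<open>For fixed \<open>v \<ge> m\<close> the edges to the first \<open>m\<close> vertices are
  distinct coin flips, all absent with probability 2^(-m).\<close>

lemma card_uncovered:
  "real (card {A \<in> edge_sets n. uncovered n m (graph_of n A)}) \<le> n * (1 / 2) ^ m * 2 ^ triangle (n - 1)"
proof -
  let ?U = "\<lambda>v. {A \<in> edge_sets n. \<forall>x\<in>{..<m}. edge_pos n x v \<notin> A}"
  have U: "real (card (?U v)) \<le> (1 / 2) ^ m * 2 ^ triangle (n - 1)" if v: "m \<le> v" "v < n" for v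
  proof -
    have "real (card (?U v)) = (\<Sum>A\<in>edge_sets n. \<Prod>x<m. of_bool (edge_pos n x v \<notin> A))"
      by (simp only: card_eq_sum_of_bool finite_Pow_iff finite_lessThan flip: of_bool_Ball)
    also have "\<dots> \<le> (1 / 2) ^ card {..<m} * 2 ^ card {..<triangle (n - 1)}"
    proof (rule sum_Pow_prod_le[where B = "\<lambda>x. {edge_pos n x v}"])
      show "{edge_pos n x v} \<subseteq> {..<triangle (n - 1)}" if "x \<in> {..<m}" for x
        using that v edge_pos_less[of x n v] by auto
      show "disjoint_family_on (\<lambda>x. {edge_pos n x v}) {..<m}"
        unfolding disjoint_family_on_def
      proof (intro ballI impI)
        fix x y assume "x \<in> {..<m}" "y \<in> {..<m}" "x \<noteq> y"
        then show "{edge_pos n x v} \<inter> {edge_pos n y v} = {}"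
          using v by (simp add: edge_pos_eq_iff)
      qed
    qed (auto simp: Pow_insert)
    finally show ?thesis by simp
  qed
  have "real (card {A \<in> edge_sets n. uncovered n m (graph_of n A)}) \<le>
      real (card {m..<n}) * ((1 / 2) ^ m * 2 ^ triangle (n - 1))"
    by (rule card_union_bound[where U = ?U]) (auto simp: uncovered_def graph_of_def intro!: U[simplified])
  also have "\<dots> \<le> n * ((1 / 2) ^ m * 2 ^ triangle (n - 1))"
    by (intro mult_right_mono) auto
  finally show ?thesis by (simp only: mult.assoc)
qed

text \<open>For fixed \<open>b\<close> and \<open>v\<close> every other vertex has its own two edges
  to them, and three of their four states prevent a common neighbour.\<close>

lemma card_distant:
  "real (card {A \<in> edge_sets n. distant n (graph_of n A)}) \<le> n\<^sup>2 * (3 / 4) ^ (n - 2) * 2 ^ triangle (n - 1)"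
proof -
  let ?I = "\<lambda>b v. {..<n} - {b, v}"
  let ?U = "\<lambda>b v. {A \<in> edge_sets n. \<forall>x\<in>?I b v. \<not> (edge_pos n b x \<in> A \<and> edge_pos n x v \<in> A)}"
  have U: "real (card (?U b v)) \<le> (3 / 4) ^ (n - 2) * 2 ^ triangle (n - 1)"
    if bv: "b < n" "v < n" "b \<noteq> v" for b v
  proof -
    have "real (card (?U b v)) =
        (\<Sum>A\<in>edge_sets n. \<Prod>x\<in>?I b v. of_bool (\<not> (edge_pos n b x \<in> A \<and> edge_pos n x v \<in> A)))"
      by (simp only: card_eq_sum_of_bool finite_Pow_iff finite_lessThan finite_Diff flip: of_bool_Ball)
    also have "\<dots> \<le> (3 / 4) ^ card (?I b v) * 2 ^ card {..<triangle (n - 1)}"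
    proof (rule sum_Pow_prod_le[where B = "\<lambda>x. {edge_pos n b x, edge_pos n x v}"])
      show "{edge_pos n b x, edge_pos n x v} \<subseteq> {..<triangle (n - 1)}" if "x \<in> ?I b v" for x
        using that bv edge_pos_less[of x n v] edge_pos_less[of b n x] by auto
      show "disjoint_family_on (\<lambda>x. {edge_pos n b x, edge_pos n x v}) (?I b v)"
        unfolding disjoint_family_on_def
      proof (intro ballI impI)
        fix x y assume "x \<in> ?I b v" "y \<in> ?I b v" "x \<noteq> y"
        then show "{edge_pos n b x, edge_pos n x v} \<inter> {edge_pos n b y, edge_pos n y v} = {}"
          using bv by (auto simp: edge_pos_eq_iff)
      qed
      show "(\<Sum>A\<in>Pow {edge_pos n b x, edge_pos n x v}.
          of_bool (\<not> (edge_pos n b x \<in> A \<and> edge_pos n x v \<in> A)))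
          \<le> 3 / 4 * (2 :: real) ^ card {edge_pos n b x, edge_pos n x v}" if "x \<in> ?I b v" for x
      proof -
        have ne: "edge_pos n b x \<noteq> edge_pos n x v"
          using that bv by (simp add: edge_pos_eq_iff)
        have "Pow {p, q} = {{}, {p}, {q}, {p, q}}" for p q :: nat
          by (auto simp: Pow_insert)
        with ne show ?thesis by (simp add: doubleton_eq_iff)
      qed
    qed auto
    also have "card (?I b v) = n - 2"
      using bv by (simp add: card_Diff_subset)
    finally show ?thesis by simp
  qed
  let ?J = "SIGMA b:{..<n}. {..<n} - {b}"
  have "real (card {A \<in> edge_sets n. distant n (graph_of n A)}) \<le>
      real (card ?J) * ((3 / 4) ^ (n - 2) * 2 ^ triangle (n - 1))"
    by (rule card_union_bound[where U = "\<lambda>(b, v). ?U b v"])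
      (auto simp: distant_def graph_of_def intro!: U[simplified])
  also have "card ?J \<le> card ({..<n} \<times> {..<n})"
    by (intro card_mono) auto
  then have "real (card ?J) * ((3 / 4) ^ (n - 2) * 2 ^ triangle (n - 1)) \<le>
      n\<^sup>2 * ((3 / 4) ^ (n - 2) * 2 ^ triangle (n - 1))"
    by (intro mult_right_mono) (auto simp: power2_eq_square simp flip: of_nat_mult)
  finally show ?thesis by (simp only: mult.assoc of_nat_power)
qed

text \<open>Fixing the edges at \<open>b\<close> first fixes its neighbours. The entries for
  different destinations then depend on disjoint sets of remaining edges, so their moments
  multiply.\<close>

lemma sum_power_hops:
  assumes b: "b < n"
  shows "(\<Sum>A\<in>edge_sets n. (3 / 2) ^ (\<Sum>v<n. Suc (hops n (graph_of n A) b v)))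
    \<le> (3 :: real) ^ n * 2 ^ triangle (n - 1)"
proof -
  let ?W = "{..<triangle (n - 1)}"
  define T where "T = edge_pos n b ` ({..<n} - {b})"
  have T: "T \<subseteq> ?W"
    using b edge_pos_less[of b n] by (auto simp: T_def)
  define M where "M D = {x. x < n \<and> x \<noteq> b \<and> edge_pos n b x \<in> D}" for D
  \<comment> \<open>The moment of the entry for \<open>v\<close> as a function of the edges
    \<open>A\<close> away from \<open>b\<close>; \<open>B D v\<close> below collects the edges on
    which it depends.\<close>
  define f where "f D v A = (3 / 2 :: real) ^ Suc (if b = v \<or> v \<in> M D then 0
      else card {x \<in> M D. \<forall>y\<in>M D. y \<le> x \<longrightarrow> edge_pos n y v \<notin> A})" for D v A
  define B where "B D v = (if b = v \<or> v \<in> M D then {} else (\<lambda>x. edge_pos n x v) ` M D)" for D v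
  have fin: "finite (M D)" for D by (simp add: M_def)
  have cross: "edge_pos n x v \<notin> T" if "x \<in> M D" "b \<noteq> v" "v \<notin> M D" "v < n" for D x v
  proof -
    have "edge_pos n x v \<noteq> edge_pos n b y" if "y < n" "y \<noteq> b" for y
      using that \<open>x \<in> M D\<close> \<open>b \<noteq> v\<close> \<open>v \<notin> M D\<close> \<open>v < n\<close> b
      by (subst edge_pos_eq_iff) (auto simp: M_def)
    then show ?thesis
      by (auto simp: T_def)
  qed
  have hops: "(3 / 2) ^ Suc (hops n (graph_of n (D \<union> A)) b v) = f D v A"
    if D: "D \<subseteq> T" and A: "A \<subseteq> ?W - T" and v: "v < n" for D A v
  proof -
    have nb: "graph_of n (D \<union> A) b x \<longleftrightarrow> x \<in> M D" for x
      using A b by (auto simp: graph_of_def M_def T_def)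
    have nv: "graph_of n (D \<union> A) y v \<longleftrightarrow> edge_pos n y v \<in> A" if "y \<in> M D" "b \<noteq> v" "v \<notin> M D" for y
      using D cross[OF that(1) that(2,3) v] that v by (auto simp: graph_of_def M_def)
    have "(\<Sum>x<n. of_bool (x \<in> M D \<and> (\<forall>y<Suc x. \<not> (y \<in> M D \<and> graph_of n (D \<union> A) y v)))) =
        card {x \<in> M D. \<forall>y\<in>M D. y \<le> x \<longrightarrow> edge_pos n y v \<notin> A}" if "b \<noteq> v" "v \<notin> M D"
    proof -
      have "(\<Sum>x<n. of_bool (x \<in> M D \<and> (\<forall>y<Suc x. \<not> (y \<in> M D \<and> graph_of n (D \<union> A) y v)))) =
        card ({..<n} \<inter> {x. x \<in> M D \<and> (\<forall>y<Suc x. \<not> (y \<in> M D \<and> graph_of n (D \<union> A) y v))})"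
        by (simp add: of_bool_def sum.If_cases)
      also have "{..<n} \<inter> {x. x \<in> M D \<and> (\<forall>y<Suc x. \<not> (y \<in> M D \<and> graph_of n (D \<union> A) y v))} =
          {x \<in> M D. \<forall>y\<in>M D. y \<le> x \<longrightarrow> edge_pos n y v \<notin> A}"
        using nv that by (auto simp: M_def less_Suc_eq_le)
      finally show ?thesis .
    qed
    then show ?thesis
      unfolding hops_def f_def nb by simp
  qed
  have inner: "(\<Sum>A\<in>Pow (?W - T). \<Prod>v<n. f D v A) \<le> 3 ^ card {..<n} * 2 ^ card (?W - T)"
    if D: "D \<subseteq> T" for D
  proof (rule sum_Pow_prod_le[where B = "B D"])
    show "B D v \<subseteq> ?W - T" if "v \<in> {..<n}" for v
    proof
      fix p assume "p \<in> B D v"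
      then obtain x where x: "x \<in> M D" "p = edge_pos n x v" "b \<noteq> v" "v \<notin> M D"
        by (auto simp: B_def split: if_splits)
      then show "p \<in> ?W - T"
        using edge_pos_less[of x n v] cross \<open>v \<in> {..<n}\<close> by (auto simp: M_def)
    qed
    show "disjoint_family_on (B D) {..<n}"
      unfolding disjoint_family_on_def
    proof (intro ballI impI)
      fix v w assume "v \<in> {..<n}" "w \<in> {..<n}" "v \<noteq> w"
      \<comment> \<open>A common edge would force \<open>x = w\<close>, but \<open>x\<close> is a
        neighbour of \<open>b\<close> and \<open>w\<close> is not.\<close>
      moreover have "edge_pos n x v \<noteq> edge_pos n y w"
        if "x \<in> M D" "y \<in> M D" "v \<notin> M D" "w \<notin> M D" for x y
      proof -
        have "x < n" "y < n" "x \<noteq> v" "y \<noteq> w"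
          using that by (auto simp: M_def)
        with calculation show ?thesis
          using that by (subst edge_pos_eq_iff) auto
      qed
      ultimately show "B D v \<inter> B D w = {}"
        by (auto simp: B_def)
    qed
    show "f D v (A \<inter> B D v) = f D v A" if "v \<in> {..<n}" for v A
      by (auto simp: f_def B_def intro!: arg_cong[of _ _ "\<lambda>k. (3 / 2) ^ Suc k"] arg_cong[of _ _ card])
    show "(\<Sum>A\<in>Pow (B D v). f D v A) \<le> 3 * 2 ^ card (B D v)" if "v \<in> {..<n}" for v
    proof (cases "b = v \<or> v \<in> M D")
      case True
      then show ?thesis by (simp add: B_def f_def)
    next
      case False
      let ?e = "\<lambda>x. edge_pos n x v"
      have inj: "inj_on ?e (M D)"
      proof (rule inj_onI)
        fix x y assume "x \<in> M D" "y \<in> M D" "?e x = ?e y"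
        moreover from this have "x < n" "y < n" "x \<noteq> v" "y \<noteq> v"
          using False by (auto simp: M_def)
        ultimately show "x = y"
          using that by (subst (asm) edge_pos_eq_iff) auto
      qed
      have "(\<Sum>A\<in>Pow (B D v). f D v A) = (\<Sum>A\<in>Pow (M D). f D v (?e ` A))"
        unfolding B_def using False image_Pow_surj[OF refl, of ?e "M D"]
        by (simp add: sum.reindex[OF inj_on_image_Pow[OF inj], simplified comp_def, symmetric])
      also have "\<dots> = (\<Sum>A\<in>Pow (M D). (3 / 2) ^ Suc (card {x \<in> M D. \<forall>y\<in>M D. y \<le> x \<longrightarrow> y \<notin> A}))"
      proof (intro sum.cong refl)
        fix A assume "A \<in> Pow (M D)"
        then have "?e y \<in> ?e ` A \<longleftrightarrow> y \<in> A" if "y \<in> M D" for y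
          using inj that by (auto dest: inj_onD)
        then have "{x \<in> M D. \<forall>y\<in>M D. y \<le> x \<longrightarrow> ?e y \<notin> ?e ` A} = {x \<in> M D. \<forall>y\<in>M D. y \<le> x \<longrightarrow> y \<notin> A}"
          by blast
        then show "f D v (?e ` A) = (3 / 2) ^ Suc (card {x \<in> M D. \<forall>y\<in>M D. y \<le> x \<longrightarrow> y \<notin> A})"
          using False by (simp add: f_def)
      qed
      also have "\<dots> \<le> 3 * 2 ^ card (M D)"
        by (rule sum_Pow_geometric_le[OF fin])
      also have "card (M D) = card (B D v)"
        using False inj by (simp add: B_def card_image)
      finally show ?thesis .
    qed
  qed (auto simp: f_def)
  have "(\<Sum>A\<in>edge_sets n. (3 / 2 :: real) ^ (\<Sum>v<n. Suc (hops n (graph_of n A) b v))) =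
      (\<Sum>D\<in>Pow T. \<Sum>A\<in>Pow (?W - T). (3 / 2) ^ (\<Sum>v<n. Suc (hops n (graph_of n (D \<union> A)) b v)))"
    by (rule sum_Pow_split[OF _ T]) simp
  also have "\<dots> = (\<Sum>D\<in>Pow T. \<Sum>A\<in>Pow (?W - T). \<Prod>v<n. f D v A)"
    unfolding power_sum by (intro sum.cong prod.cong refl hops) auto
  also have "\<dots> \<le> (\<Sum>D\<in>Pow T. 3 ^ card {..<n} * 2 ^ card (?W - T))"
    by (intro sum_mono inner) auto
  also have "\<dots> = 3 ^ n * 2 ^ triangle (n - 1)"
  proof -
    have "card ?W = card T + card (?W - T)"
      using T by (metis card_Diff_subset card_mono finite_lessThan finite_subset le_add_diff_inverse)
    then have "triangle (n - 1) = card T + card (?W - T)" by simp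
    moreover have "finite T" by (simp add: T_def)
    ultimately show ?thesis
      by (simp add: card_Pow flip: power_add)
  qed
  finally show ?thesis .
qed

text \<open>Markov's inequality to base 3/2: the threshold has weight \<open>(27 / 8) ^ n\<close>,
  the mean is at most \<open>3 ^ n\<close>.\<close>

lemma card_long_table:
  "real (card {A \<in> edge_sets n. long_table n (graph_of n A)}) \<le> n * (8 / 9) ^ n * 2 ^ triangle (n - 1)"
proof -
  let ?h = "\<lambda>b A. \<Sum>v<n. Suc (hops n (graph_of n A) b v)"
  let ?U = "\<lambda>b. {A \<in> edge_sets n. 3 * n < ?h b A}"
  have U: "real (card (?U b)) \<le> (8 / 9) ^ n * 2 ^ triangle (n - 1)" if b: "b < n" for b
  proof -
    have "(3 / 2) ^ (3 * n) * real (card (?U b)) = (\<Sum>A\<in>?U b. (3 / 2) ^ (3 * n))"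
      by simp
    also have "\<dots> \<le> (\<Sum>A\<in>?U b. (3 / 2) ^ ?h b A)"
      by (intro sum_mono power_increasing) auto
    also have "\<dots> \<le> (\<Sum>A\<in>edge_sets n. (3 / 2) ^ ?h b A)"
      by (intro sum_mono2) auto
    also have "\<dots> \<le> 3 ^ n * 2 ^ triangle (n - 1)"
      by (rule sum_power_hops[OF b])
    also have "(3 :: real) ^ n = (3 / 2) ^ (3 * n) * (8 / 9) ^ n"
      unfolding power_mult by (simp add: power_mult_distrib[symmetric] power3_eq_cube)
    finally have "(3 / 2) ^ (3 * n) * real (card (?U b)) \<le>
        (3 / 2) ^ (3 * n) * ((8 / 9) ^ n * 2 ^ triangle (n - 1))"
      by (simp only: mult.assoc)
    then show ?thesis
      by (rule mult_left_le_imp_le) simp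
  qed
  have "real (card {A \<in> edge_sets n. long_table n (graph_of n A)}) \<le>
      real (card {..<n}) * ((8 / 9) ^ n * 2 ^ triangle (n - 1))"
    by (rule card_union_bound[where U = ?U]) (auto simp: long_table_def intro!: U[simplified])
  then show ?thesis by simp
qed

section \<open>Random graphs are typical\<close>

text \<open>The two inequalities determine \<open>l\<close> as floor(log n), in a form that is
  decidable by bounded search.\<close>

definition atypical :: "nat \<Rightarrow> nat \<Rightarrow> (nat \<Rightarrow> nat \<Rightarrow> bool) \<Rightarrow> bool" where
  "atypical n d g \<longleftrightarrow>
     (\<exists>l<n. 2 ^ l \<le> n \<and> n < 2 ^ Suc l \<and> uncovered n (d + 2 * l) g) \<or> distant n g \<or> long_table n g"

text \<open>A pair code bounds its components, hence the bounds on \<open>n\<close> and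
  \<open>d\<close>. The range of \<open>Suc z\<close> prescribes the marker position, that is, the
  length of the coded string, and makes the class finite.\<close>

definition atypical_code :: "nat \<Rightarrow> nat \<Rightarrow> bool" where
  "atypical_code y z \<longleftrightarrow> (\<exists>n<Suc y. \<exists>d<Suc y. prod_encode (n, d) = y \<and>
     2 ^ triangle (n - 1) \<le> Suc z \<and> Suc z < 2 ^ Suc (triangle (n - 1)) \<and>
     atypical n d (graph_of n (bits (Suc z))))"

lemma decidable_graph_of:
  assumes "computable k F" "computable k G" "computable k H" "computable k I"
  shows "decidable k (\<lambda>e. graph_of (F e) (bits (G e)) (H e) (I e))"
  unfolding graph_of_def edge_pos_def max_def min_def mem_Collect_eq
  by (intro computable_intros decidable_bit computable_prod_encode assms)

lemma computable_hops:
  assumes "computable k F" "computable k G" "computable k H" "computable k I"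
  shows "computable k (\<lambda>e. hops (F e) (graph_of (F e) (bits (G e))) (H e) (I e))"
proof -
  have "computable 4 (\<lambda>e. hops (env e 0) (graph_of (env e 0) (bits (env e 1))) (env e 2) (env e 3))"
    unfolding hops_def
    by (intro computable_intros decidable_graph_of)
      (simp_all add: computable_env computable_Suc)
  then show ?thesis
    using assms by (rule computable_quaternary[where f = "\<lambda>n X. hops n (graph_of n (bits X))"])
qed

lemma decidable_atypical_code: "decidable 2 (\<lambda>e. atypical_code (env e 0) (env e 1))"
  unfolding atypical_code_def atypical_def uncovered_def distant_def long_table_def
  by (intro computable_intros computable_prod_encode computable_triangle computable_hops decidable_graph_of)
    (simp_all add: computable_env computable_intros)

lemma bit_top:
  fixes X :: nat
  assumes "2 ^ N \<le> X" "X < 2 ^ Suc N" "N \<le> j"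
  shows "bit X j \<longleftrightarrow> j = N"
proof -
  have "X > 0" using assms(1) by (metis less_le_trans pos2 zero_less_power)
  then obtain ys where ys: "bin_val ys = X" using bin_val_surj by blast
  have "(2 :: nat) ^ length ys < 2 ^ Suc N" "(2 :: nat) ^ N < 2 ^ Suc (length ys)"
    using bin_val_bounds[of ys] assms unfolding ys by linarith+
  then have "length ys = N"
    by (simp del: power_Suc)
  then show ?thesis
    using assms(3) bit_bin_val[of ys j] ys by auto
qed

text \<open>With the marker prescribed, a code is determined by the bits below it, and the graph
  reads only these.\<close>

lemma card_atypical_code:
  fixes n d :: nat
  defines "H \<equiv> {z. atypical_code (prod_encode (n, d)) z}"
  shows "finite H" and "card H \<le> card {A \<in> edge_sets n. atypical n d (graph_of n A)}"
proof -
  let ?N = "triangle (n - 1)"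
  let ?h = "\<lambda>z. {j. j < ?N \<and> bit (Suc z) j}"
  have H: "2 ^ ?N \<le> Suc z" "Suc z < 2 ^ Suc ?N" "atypical n d (graph_of n (bits (Suc z)))"
    if "z \<in> H" for z
    using that by (auto simp: H_def atypical_code_def)
  then have "H \<subseteq> {..<2 ^ Suc ?N}" by force
  then show "finite H" by (rule finite_subset) simp
  show "card H \<le> card {A \<in> edge_sets n. atypical n d (graph_of n A)}"
  proof (rule card_inj_on_le)
    show "inj_on ?h H"
    proof (rule inj_onI)
      fix x y assume "x \<in> H" "y \<in> H" and eq: "?h x = ?h y"
      have "bit (Suc x) j \<longleftrightarrow> bit (Suc y) j" for j
      proof (cases "j < ?N")
        case True
        then show ?thesis using eq by blast
      next
        case False
        then show ?thesis using bit_top[OF H(1,2)] \<open>x \<in> H\<close> \<open>y \<in> H\<close> by auto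
      qed
      then have "Suc x = Suc y" by (intro bit_eqI) auto
      then show "x = y" by simp
    qed
    have "graph_of n (bits (Suc z)) = graph_of n (?h z)" for z
      using edge_pos_less by (auto simp: graph_of_def fun_eq_iff)
    then show "?h ` H \<subseteq> {A \<in> edge_sets n. atypical n d (graph_of n A)}"
      using H(3) by auto
  qed simp
qed

lemma card_atypical:
  assumes "n > 0" "c * log 2 n \<le> real d"
  shows "real (card {A \<in> edge_sets n. atypical n d (graph_of n A)}) \<le>
    (4 * real n powr (- c - 1) + 2 * (real n)\<^sup>2 * (3 / 4) ^ n + real n * (8 / 9) ^ n) * 2 ^ triangle (n - 1)"
proof -
  let ?N = "triangle (n - 1)"
  obtain l where l: "2 ^ l \<le> n" "n < 2 ^ Suc l"
    using ex_power_ivl1[of 2 n] assms(1) by auto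
  have l_unique: "l' = l" if "2 ^ l' \<le> n" "n < 2 ^ Suc l'" for l'
  proof -
    have "(2 :: nat) ^ l < 2 ^ Suc l'" "(2 :: nat) ^ l' < 2 ^ Suc l"
      using l that by linarith+
    then show ?thesis by (simp del: power_Suc)
  qed
  \<comment> \<open>The choice of \<open>d\<close> gives 2^(-d) <= n^(-c), and
    \<open>n < 2 ^ Suc l\<close> gives 2^(-2l) <= 4/n^2.\<close>
  have covered: "n * (1 / 2) ^ (d + 2 * l) \<le> 4 * real n powr (- c - 1)"
  proof -
    have "(1 / 2 :: real) ^ d = 2 powr (- real d)"
      by (simp add: powr_minus powr_realpow power_one_over inverse_eq_divide)
    also have "\<dots> \<le> 2 powr (- (c * log 2 n))"
      using assms(2) by simp
    also have "\<dots> = real n powr - c"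
      using assms(1) by (simp add: powr_def log_def)
    finally have d: "(1 / 2 :: real) ^ d \<le> real n powr - c" .
    have "real n \<le> 2 * 2 ^ l"
      using l(2) by (simp flip: of_nat_less_iff[where ?'a = real])
    then have "real n * real n \<le> (2 * 2 ^ l) * (2 * 2 ^ l)"
      by (intro mult_mono) auto
    then have "(1 / 2 :: real) ^ (2 * l) \<le> 4 / (real n)\<^sup>2"
      using assms(1) by (simp add: power_mult power2_eq_square field_simps power_mult_distrib[symmetric])
    then have "n * (1 / 2) ^ (d + 2 * l) \<le> n * (real n powr - c * (4 / (real n)\<^sup>2))"
      unfolding power_add using d by (intro mult_left_mono mult_mono) auto
    also have "\<dots> = 4 * real n powr (- c - 1)"
      using assms(1) by (simp add: powr_diff power2_eq_square)
    finally show ?thesis .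
  qed
  \<comment> \<open>The factor 2 exceeds (4/3)^2; for n = 1 the truncated exponent is 0.\<close>
  have three_quarters: "(3 / 4 :: real) ^ (n - 2) \<le> 2 * (3 / 4) ^ n"
  proof (cases "n \<ge> 2")
    case True
    then have "(3 / 4 :: real) ^ n = (3 / 4) ^ (n - 2) * (3 / 4)\<^sup>2"
      by (metis le_add_diff_inverse2 power_add)
    moreover have "x \<le> 2 * (x * (3 / 4)\<^sup>2)" if "x \<ge> 0" for x :: real
      using that by (simp add: power2_eq_square)
    ultimately show ?thesis by simp
  next
    case False
    with assms(1) have "n = 1" by simp
    then show ?thesis by simp
  qed
  let ?G = "\<lambda>P. {A \<in> edge_sets n. P (graph_of n A)}"
  have "?G (atypical n d) \<subseteq> ?G (uncovered n (d + 2 * l)) \<union> (?G (distant n) \<union> ?G (long_table n))"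
    using l_unique by (auto simp: atypical_def)
  then have "card (?G (atypical n d)) \<le>
      card (?G (uncovered n (d + 2 * l)) \<union> (?G (distant n) \<union> ?G (long_table n)))"
    by (intro card_mono) auto
  also have "\<dots> \<le> card (?G (uncovered n (d + 2 * l))) + (card (?G (distant n)) + card (?G (long_table n)))"
    using card_Un_le[of "?G (uncovered n (d + 2 * l))" "?G (distant n) \<union> ?G (long_table n)"]
      card_Un_le[of "?G (distant n)" "?G (long_table n)"] by linarith
  finally have "real (card (?G (atypical n d))) \<le> real (card (?G (uncovered n (d + 2 * l)))) +
      (real (card (?G (distant n))) + real (card (?G (long_table n))))"
    by linarith
  also have "\<dots> \<le> n * (1 / 2) ^ (d + 2 * l) * 2 ^ ?N +
      ((real n)\<^sup>2 * (3 / 4) ^ (n - 2) * 2 ^ ?N + n * (8 / 9) ^ n * 2 ^ ?N)"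
    by (intro add_mono card_uncovered card_distant card_long_table)
  also have "\<dots> \<le> 4 * real n powr (- c - 1) * 2 ^ ?N +
      ((real n)\<^sup>2 * (2 * (3 / 4) ^ n) * 2 ^ ?N + n * (8 / 9) ^ n * 2 ^ ?N)"
    by (intro add_mono order_refl mult_right_mono[OF covered]
        mult_right_mono[OF mult_left_mono[OF three_quarters]]) simp_all
  also have "\<dots> = (4 * real n powr (- c - 1) + 2 * (real n)\<^sup>2 * (3 / 4) ^ n + real n * (8 / 9) ^ n) * 2 ^ ?N"
    by (simp only: distrib_right distrib_left mult_ac add_ac)
  finally show ?thesis .
qed

text \<open>With N possible edges, a counterexample gives 2^N / n^c <= 2^KC <= 2^c0 eps(n) 2^N, but
  n^c eps(n) tends to 0; its slowest summand is 4/n.\<close>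

lemma random_not_atypical:
  assumes "universal U"
  shows "\<forall>\<^sub>F n in sequentially. \<forall>E. is_graph n E \<and> delta_random U (\<lambda>m. c * log 2 (real m)) n E \<longrightarrow>
    \<not> atypical n (nat \<lceil>c * log 2 (real n)\<rceil>) (zero_based n E)"
proof -
  obtain c0 where c0: "\<And>x y. atypical_code y (code x) \<Longrightarrow> finite {z. atypical_code y z} \<Longrightarrow>
      2 ^ KC U x y \<le> (2 ^ c0 * card {z. atypical_code y z} :: nat)"
    using KC_le_card[OF assms decidable_atypical_code] by blast
  let ?\<epsilon> = "\<lambda>n. 4 * real n powr (- c - 1) + 2 * (real n)\<^sup>2 * (3 / 4) ^ n + real n * (8 / 9) ^ n"
  have "(\<lambda>n. real n powr c * (4 * real n powr (- c - 1))) \<longlonglongrightarrow> 0"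
    by real_asymp
  moreover have "(\<lambda>n. real n powr c * (2 * (real n)\<^sup>2 * (3 / 4) ^ n)) \<longlonglongrightarrow> 0"
    by real_asymp
  moreover have "(\<lambda>n. real n powr c * (real n * (8 / 9) ^ n)) \<longlonglongrightarrow> 0"
    by real_asymp
  ultimately have "(\<lambda>n. real n powr c * (4 * real n powr (- c - 1)) +
      real n powr c * (2 * (real n)\<^sup>2 * (3 / 4) ^ n) + real n powr c * (real n * (8 / 9) ^ n)) \<longlonglongrightarrow> 0 + 0 + 0"
    by (intro tendsto_add)
  then have "(\<lambda>n. real n powr c * ?\<epsilon> n) \<longlonglongrightarrow> 0"
    by (simp add: distrib_left)
  then have "\<forall>\<^sub>F n in sequentially. real n powr c * ?\<epsilon> n < 1 / 2 ^ c0"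
    by (rule order_tendstoD) simp
  with eventually_gt_at_top[of 0] show ?thesis
  proof eventually_elim
    case (elim n)
    \<comment> \<open>This is the rounded deficiency that \<open>rand_cond\<close> supplies, so the
      test never has to evaluate \<open>c\<close>.\<close>
    define d where "d = nat \<lceil>c * log 2 n\<rceil>"
    then have d: "c * log 2 n \<le> real d"
      by (simp add: real_nat_ceiling_ge)
    let ?N = "triangle (n - 1)"
    show ?case
    proof (intro allI impI notI)
      fix E
      assume E: "is_graph n E \<and> delta_random U (\<lambda>m. c * log 2 (real m)) n E"
        and bad: "atypical n (nat \<lceil>c * log 2 n\<rceil>) (zero_based n E)"
      let ?x = "edge_code n E" and ?y = "prod_encode (n, d)"
      have "2 ^ ?N \<le> Suc (code ?x)" "Suc (code ?x) < 2 ^ Suc ?N"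
        using bin_val_bounds[of "rev ?x"] by (simp_all add: Suc_code length_edge_code)
      then have "atypical_code ?y (code ?x)"
        using bad graph_of_edge_code[of n E] E le_prod_encode_1[of n d] le_prod_encode_2[of d n]
        unfolding atypical_code_def by (auto simp: d_def less_Suc_eq_le)
      then have "2 ^ KC U ?x ?y \<le> 2 ^ c0 * card {z. atypical_code ?y z}"
        using c0 card_atypical_code(1) by blast
      also have "\<dots> \<le> 2 ^ c0 * card {A \<in> edge_sets n. atypical n d (graph_of n A)}"
        using card_atypical_code(2) by simp
      finally have "real (2 ^ KC U ?x ?y) \<le> real (2 ^ c0 * card {A \<in> edge_sets n. atypical n d (graph_of n A)})"
        by (simp only: of_nat_le_iff)
      also have "\<dots> \<le> 2 ^ c0 * (?\<epsilon> n * 2 ^ ?N)"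
        using mult_left_mono[OF card_atypical[OF elim(1) d], of "2 ^ c0"] by simp
      finally have upper: "2 ^ KC U ?x ?y \<le> 2 ^ c0 * (?\<epsilon> n * 2 ^ ?N)"
        by simp
      have "n * (n - 1) div 2 = ?N"
        using elim by (cases n) (simp_all add: triangle_def mult.commute)
      then have "real ?N - c * log 2 n \<le> KC U ?x ?y"
        using E by (simp add: delta_random_def rand_cond_def d_def)
      then have "2 powr (real ?N - c * log 2 n) \<le> 2 powr (KC U ?x ?y)"
        by simp
      also have "2 powr (real ?N - c * log 2 n) = 2 ^ ?N / real n powr c"
        using elim by (simp add: powr_diff powr_realpow) (simp add: powr_def log_def)
      finally have "2 ^ ?N / real n powr c \<le> 2 ^ c0 * (?\<epsilon> n * 2 ^ ?N)"
        using upper by (simp add: powr_realpow)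
      then have "2 ^ ?N * 1 \<le> 2 ^ ?N * (2 ^ c0 * (real n powr c * ?\<epsilon> n))"
        using elim by (simp add: divide_le_eq mult_ac)
      then have "1 \<le> 2 ^ c0 * (real n powr c * ?\<epsilon> n)"
        by (rule mult_left_le_imp_le) simp
      with elim show False
        by (simp add: field_simps)
    qed
  qed
qed

section \<open>The routing scheme\<close>

text \<open>A neighbour \<open>w\<close> of \<open>b\<close> is counted iff no common neighbour is
  at most \<open>w\<close>, that is, iff \<open>w < x\<close>.\<close>

lemma hops_first_common:
  assumes "x < n" "g b x" "g x v" "\<And>y. y < x \<Longrightarrow> \<not> (g b y \<and> g y v)" "b \<noteq> v" "\<not> g b v"
  shows "hops n g b v = rank (g b) x"
proof -
  have "hops n g b v = card {w \<in> {..<n}. g b w \<and> (\<forall>y<Suc w. \<not> (g b y \<and> g y v))}"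
    using assms(5,6) by (simp add: hops_def of_bool_def flip: sum.inter_filter)
  also have "{w \<in> {..<n}. g b w \<and> (\<forall>y<Suc w. \<not> (g b y \<and> g y v))} = {w. w < x \<and> g b w}"
    using assms(1-4) by (auto simp: less_Suc_eq_le) (meson not_le)
  finally show ?thesis
    by (simp add: rank_eq_card)
qed

lemma route_direct:
  assumes "v \<in> {1..n}" "E u v"
  shows "route n (code (nbr_vec n E u)) t v = v"
proof -
  obtain w where "v = Suc w" "w < n" using assms(1) by (cases v) auto
  then show ?thesis
    using assms(2) by (simp add: route_def bit_nbr_vec)
qed

lemma route_relay:
  assumes "v \<in> {1..n}" "\<not> E u v"
  shows "route n (code (nbr_vec n E u)) t v =
    select n (\<lambda>w. E u (Suc w)) (zeros_at_rank (Suc t) (Suc t) (v - 1))"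
proof -
  obtain w where "v = Suc w" "w < n" using assms(1) by (cases v) auto
  then have "\<not> bit (Suc (code (nbr_vec n E u))) (n - v)"
    using assms(2) by (simp add: bit_nbr_vec)
  then show ?thesis
    unfolding route_def by (simp add: bit_nbr_vec cong: select_cong)
qed

lemma route_table:
  assumes g: "g = zero_based n E"
    and dist: "\<not> distant n g"
    and uv: "u \<in> {1..n}" "v \<in> {1..n}" "u \<noteq> v" and not_adj: "\<not> E u v"
  shows "\<exists>x. route n (code (nbr_vec n E u)) (code (rev (unary (map (hops n g (u - 1)) [0..<n])))) v = x
    \<and> E u x \<and> E x v"
proof -
  let ?P = "\<lambda>x. g (u - 1) x \<and> g x (v - 1)"
  let ?Js = "map (hops n g (u - 1)) [0..<n]"
  let ?t = "code (rev (unary ?Js))"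
  have shifted: "u - 1 < n" "v - 1 < n" "u - 1 \<noteq> v - 1" "Suc (u - 1) = u" "Suc (v - 1) = v"
    using uv by auto
  then have "\<exists>x. ?P x"
    using dist unfolding distant_def by blast
  define x where "x = (LEAST x. ?P x)"
  have x: "?P x" and least: "\<And>y. y < x \<Longrightarrow> \<not> ?P y"
    unfolding x_def using LeastI_ex[OF \<open>\<exists>x. ?P x\<close>] not_less_Least by blast+
  then have "x < n" by (simp add: g)
  have "\<not> g (u - 1) (v - 1)"
    using not_adj shifted by (simp add: g)
  then have hops: "hops n g (u - 1) (v - 1) = rank (g (u - 1)) x"
    using hops_first_common[of x n g "u - 1" "v - 1"] x least \<open>x < n\<close> shifted by blast
  \<comment> \<open>The number itself can serve as scan length, since a string of length k yields at
    least 2^k.\<close>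
  have "length (unary ?Js) \<le> Suc ?t"
    unfolding Suc_code rev_rev_ident
    using bin_val_bounds[of "unary ?Js"] less_exp[of "length (unary ?Js)"] by linarith
  then have "zeros_at_rank (Suc ?t) (Suc ?t) (v - 1) = rank (g (u - 1)) x"
    using zeros_at_rank_unary[of "v - 1" ?Js "Suc ?t"] shifted hops by (simp add: Suc_code)
  then have "route n (code (nbr_vec n E u)) ?t v = select n (\<lambda>w. E u (Suc w)) (rank (g (u - 1)) x)"
    using route_relay[of v n E u ?t] uv not_adj by simp
  also have "\<dots> = select n (g (u - 1)) (rank (g (u - 1)) x)"
    using shifted by (intro select_cong) (simp add: g)
  also have "\<dots> = Suc x"
    using x \<open>x < n\<close> by (intro select_rank) auto
  finally show ?thesis
    using x shifted by (simp add: g)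
qed

text \<open>Some neighbour of \<open>u\<close> is among the first \<open>m\<close> vertices, so the
  least one is too; the empty table yields rank 0, which selects it.\<close>

lemma route_least_neighbour:
  assumes g: "g = zero_based n E" and E: "is_graph n E"
    and "\<not> uncovered n m g" "u \<in> {1..n}" "m < u" "v \<in> {1..n}" "\<not> E u v"
  shows "\<exists>x. route n (code (nbr_vec n E u)) (code []) v = x \<and> E u x \<and> x \<le> m"
proof -
  let ?P = "\<lambda>w. E u (Suc w)"
  have "u - 1 < n" "m \<le> u - 1" "Suc (u - 1) = u"
    using assms(4,5) by auto
  then have "\<exists>w<m. g w (u - 1)"
    using assms(3) unfolding uncovered_def by blast
  then obtain w where w: "w < m" "w < n" "?P w"
    using E \<open>Suc (u - 1) = u\<close> by (auto simp: g is_graph_def)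
  define x where "x = (LEAST w. ?P w)"
  have "x \<le> w" "?P x" "\<And>y. y < x \<Longrightarrow> \<not> ?P y"
    unfolding x_def using w(3) Least_le[of ?P] LeastI[of ?P] not_less_Least[of _ ?P] by blast+
  then have "rank ?P x = 0"
    by (simp add: rank_def)
  then have "select n ?P 0 = Suc x"
    using select_rank[of x n ?P] \<open>x \<le> w\<close> w(2) \<open>?P x\<close> by simp
  moreover have "zeros_at_rank 1 1 (v - 1) = 0"
    by (simp add: zeros_at_rank_def bit_0)
  ultimately show ?thesis
    using route_relay[of v n E u "code []"] assms(6,7) \<open>x \<le> w\<close> w(1) \<open>?P x\<close> by (simp add: code_def)
qed

lemma route_length_le:
  assumes "((\<lambda>x. R x v) ^^ k) u = v"
  shows "route_reaches R u v" "route_length R u v \<le> k"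
  using assms Least_le[of "\<lambda>k. ((\<lambda>x. R x v) ^^ k) u = v" k]
  by (auto simp: route_reaches_def route_length_def)

text \<open>The common neighbour provides a path, so that the \<open>LEAST\<close> in
  \<open>gdist\<close> is attained; paths with too few vertices are then excluded.\<close>

lemma gdist_ge:
  assumes "E u x" "E x v" "u \<noteq> v"
  shows "gdist E u v \<ge> 1" and "\<not> E u v \<Longrightarrow> gdist E u v \<ge> 2"
proof -
  let ?path = "\<lambda>k ps. is_path E ps \<and> hd ps = u \<and> last ps = v \<and> length ps = Suc k"
  have "?path 2 [u, x, v]"
    using assms by (auto simp: is_path_def less_Suc_eq nth_Cons split: nat.split)
  then have "\<exists>k. \<exists>ps. ?path k ps" by blast
  from LeastI_ex[OF this] obtain ps where ps: "?path (gdist E u v) ps"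
    unfolding gdist_def by blast
  have "gdist E u v \<noteq> 0"
  proof
    assume "gdist E u v = 0"
    with ps have "length ps = Suc 0" by simp
    then show False using ps assms(3) by (auto simp: length_Suc_conv)
  qed
  then show "gdist E u v \<ge> 1" by simp
  have "gdist E u v \<noteq> 1" if "\<not> E u v"
  proof
    assume "gdist E u v = 1"
    with ps have "length ps = Suc (Suc 0)" by simp
    then show False using ps that by (auto simp: length_Suc_conv is_path_def)
  qed
  then show "gdist E u v \<ge> 2" if "\<not> E u v"
    using that \<open>gdist E u v \<noteq> 0\<close> by linarith
qed

text \<open>The worst route enters \<open>B\<close>, moves to a neighbour of the destination and is
  delivered directly: three steps for a distance of at least 2.\<close>

lemma stretch_of_relays:
  assumes E: "is_graph n E"
    and common: "\<And>u v. u \<in> {1..n} \<Longrightarrow> v \<in> {1..n} \<Longrightarrow> u \<noteq> v \<Longrightarrow> \<exists>x. E u x \<and> E x v"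
    and direct: "\<And>u v. u \<in> {1..n} \<Longrightarrow> v \<in> {1..n} \<Longrightarrow> E u v \<Longrightarrow> R u v = v"
    and relay: "\<And>u v. u \<in> B \<Longrightarrow> v \<in> {1..n} \<Longrightarrow> u \<noteq> v \<Longrightarrow> \<not> E u v \<Longrightarrow> E u (R u v) \<and> E (R u v) v"
    and to_B: "\<And>u v. u \<in> {1..n} - B \<Longrightarrow> v \<in> {1..n} \<Longrightarrow> u \<noteq> v \<Longrightarrow> \<not> E u v \<Longrightarrow> E u (R u v) \<and> R u v \<in> B"
  shows "routing_scheme n E R" and "stretch_at_most n E R 1.5"
proof -
  have vert: "x \<in> {1..n}" if "E y x" for x y
    using E that by (auto simp: is_graph_def)
  show "routing_scheme n E R"
    unfolding routing_scheme_def using direct relay to_B by (metis DiffI)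
  have within: "route_reaches R u v \<and> real (route_length R u v) \<le> 1.5 * real (gdist E u v)"
    if "((\<lambda>x. R x v) ^^ k) u = v" "2 * k \<le> 3 * gdist E u v" for u v k
    using route_length_le[where R = R and u = u and v = v and k = k] that by auto
  show "stretch_at_most n E R 1.5"
    unfolding stretch_at_most_def
  proof (intro ballI impI)
    fix u v assume uv: "u \<in> {1..n}" "v \<in> {1..n}" "u \<noteq> v"
    obtain x where x: "E u x" "E x v" using common uv by blast
    show "route_reaches R u v \<and> real (route_length R u v) \<le> 1.5 * real (gdist E u v)"
    proof (cases "E u v")
      case True
      then show ?thesis
        using gdist_ge(1)[OF x uv(3)] direct uv by (intro within[where k = 1]) auto
    next
      case far: False
      have two: "R (R w v) v = v" if "w \<in> B" "w \<noteq> v" "\<not> E w v" for w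
        using relay[OF that(1) uv(2) that(2,3)] direct uv(2) vert by blast
      show ?thesis
      proof (cases "u \<in> B")
        case True
        then show ?thesis
          using gdist_ge(2)[OF x uv(3) far] two uv far by (intro within[where k = 2]) (auto simp: numeral_2_eq_2)
      next
        case False
        let ?b = "R u v"
        have b: "E u ?b" "?b \<in> B" using to_B False uv far by auto
        then have "?b \<noteq> v" using far by metis
        show ?thesis
        proof (cases "E ?b v")
          case True
          then show ?thesis
            using gdist_ge(2)[OF x uv(3) far] direct vert[OF b(1)] uv(2)
            by (intro within[where k = 2]) (auto simp: numeral_2_eq_2)
        next
          case False
          then show ?thesis
            using gdist_ge(2)[OF x uv(3) far] two[OF b(2) \<open>?b \<noteq> v\<close>]
            by (intro within[where k = 3]) (auto simp: numeral_3_eq_3)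
        qed
      qed
    qed
  qed
qed

lemma typical_scheme:
  fixes m :: nat
  assumes E: "is_graph n E" and g: "g = zero_based n E"
    and unc: "\<not> uncovered n m g" and dist: "\<not> distant n g" and long: "\<not> long_table n g"
    and Dec: "\<And>e. length e = 5 \<Longrightarrow> eval Dec e (route (env e 0) (env e 2) (env e 3) (env e 4))"
  shows "\<exists>R b B. routing_scheme n E R \<and> stretch_at_most n E R 1.5 \<and> stored_by Dec n E R b \<and>
    B \<subseteq> {1..n} \<and> card B \<le> m \<and> (\<forall>u\<in>{1..n} - B. b u = []) \<and> (\<forall>u\<in>B. length (b u) \<le> 3 * n)"
proof -
  \<comment> \<open>The bound \<open>m\<close> may exceed \<open>n\<close> here, hence the
    intersection.\<close>
  define B where "B = {1..n} \<inter> {1..m}"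
  \<comment> \<open>The \<open>rev\<close> cancels the one in \<open>code\<close>, which puts the
    first entry at the lowest bits.\<close>
  define b where "b u = (if u \<in> B then rev (unary (map (hops n g (u - 1)) [0..<n])) else [])" for u
  define R where "R u v = route n (code (nbr_vec n E u)) (code (b u)) v" for u v
  have "\<exists>x. E u x \<and> E x v" if "u \<in> {1..n}" "v \<in> {1..n}" "u \<noteq> v" for u v
  proof -
    have "u - 1 < n" "v - 1 < n" "u - 1 \<noteq> v - 1" "Suc (u - 1) = u" "Suc (v - 1) = v"
      using that by auto
    then show ?thesis
      using dist unfolding distant_def g by metis
  qed
  moreover have "R u v = v" if "v \<in> {1..n}" "E u v" for u v
    using that by (simp add: R_def route_direct)
  moreover have "E u (R u v) \<and> E (R u v) v" if "u \<in> B" "v \<in> {1..n}" "u \<noteq> v" "\<not> E u v" for u v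
    using route_table[OF g dist, of u v] that by (auto simp: R_def b_def B_def)
  moreover have "E u (R u v) \<and> R u v \<in> B" if "u \<in> {1..n} - B" "v \<in> {1..n}" "u \<noteq> v" "\<not> E u v" for u v
    using route_least_neighbour[OF g E unc, of u v] that E
    by (auto simp: R_def b_def B_def is_graph_def)
  ultimately have "routing_scheme n E R" "stretch_at_most n E R 1.5"
    using stretch_of_relays[OF E, of R B] by blast+
  moreover have "stored_by Dec n E R b"
    unfolding stored_by_def
    using Dec[of "[n, _, code (nbr_vec n E _), code (b _), _]"]
    by (simp add: R_def eval_nat_numeral)
  moreover have "length (b u) \<le> 3 * n" if "u \<in> B" for u
  proof -
    have "u - 1 < n" using that by (auto simp: B_def)
    then have "(\<Sum>v<n. Suc (hops n g (u - 1) v)) \<le> 3 * n"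
      using long unfolding long_table_def by (meson not_le)
    then show ?thesis
      using that by (simp add: b_def length_unary sum_list_sum_nth lessThan_atLeast0 comp_def)
  qed
  moreover have "card B \<le> m"
    unfolding B_def using card_mono[of "{1..m}" "{1..n} \<inter> {1..m}"] by simp
  moreover have "B \<subseteq> {1..n}" "\<forall>u\<in>{1..n} - B. b u = []"
    by (auto simp: B_def b_def)
  ultimately show ?thesis by blast
qed

theorem theorem3:
  fixes c :: real and U :: recf
  assumes "c \<ge> 0" and "universal U"
  shows "\<exists>Dec K N0. \<forall>n\<ge>N0. \<forall>E. is_graph n E \<and> delta_random U (\<lambda>m. c * log 2 (real m)) n E \<longrightarrow>
     (\<exists>R b B. routing_scheme n E R \<and> stretch_at_most n E R 1.5 \<and> stored_by Dec n E R b \<and>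
        B \<subseteq> {1..n} \<and> real (card B) \<le> 1 + (c + 3) * log 2 (real n) \<and>
        (\<forall>u\<in>{1..n} - B. real (length (b u)) \<le> real_of_int \<lceil>log 2 (real n + 1)\<rceil> + real K) \<and>
        (\<forall>u\<in>B. length (b u) \<le> 3 * n) \<and>
        real (\<Sum>u\<in>{1..n}. length (b u)) < (3 * c + 20) * real n * log 2 (real n))"
proof -
  obtain Dec where Dec: "\<And>e. length e = 5 \<Longrightarrow> eval Dec e (route (env e 0) (env e 2) (env e 3) (env e 4))"
    using computable_route unfolding computable_def by blast
  obtain N1 where N1: "\<And>n E. n \<ge> N1 \<Longrightarrow> is_graph n E \<Longrightarrow> delta_random U (\<lambda>m. c * log 2 (real m)) n E \<Longrightarrow>
      \<not> atypical n (nat \<lceil>c * log 2 (real n)\<rceil>) (zero_based n E)"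
    using random_not_atypical[OF assms(2)] unfolding eventually_sequentially by blast
  show ?thesis
  \<comment> \<open>The constant is 0 because nothing is stored outside \<open>B\<close>;
    \<open>n \<ge> 2\<close> ensures that the logarithm is at least 1.\<close>
  proof (rule exI[of _ Dec], rule exI[of _ 0], rule exI[of _ "max N1 2"], intro allI impI)
    fix n E
    assume n: "max N1 2 \<le> n" and E: "is_graph n E \<and> delta_random U (\<lambda>m. c * log 2 (real m)) n E"
    define g where "g = zero_based n E"
    define d where "d = nat \<lceil>c * log 2 (real n)\<rceil>"
    have typical: "\<not> atypical n d g"
      using N1[of n E] n E by (simp add: g_def d_def)
    obtain l where l: "2 ^ l \<le> n" "n < 2 ^ Suc l"
      using ex_power_ivl1[of 2 n] n by auto
    moreover have "l < n"
      using l(1) less_exp[of l] by linarith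
    ultimately have unc: "\<not> uncovered n (d + 2 * l) g" "\<not> distant n g" "\<not> long_table n g"
      using typical unfolding atypical_def by blast+
    obtain R b B where scheme: "routing_scheme n E R" "stretch_at_most n E R 1.5" "stored_by Dec n E R b"
      and B: "B \<subseteq> {1..n}" "card B \<le> d + 2 * l" "\<forall>u\<in>{1..n} - B. b u = []" "\<forall>u\<in>B. length (b u) \<le> 3 * n"
      using typical_scheme[OF conjunct1[OF E] g_def unc Dec] by blast
    let ?L = "log 2 (real n)"
    have L: "?L \<ge> 1" using n by simp
    have "real l \<le> ?L"
      using l(1) n by (simp add: le_log_iff powr_realpow)
    \<comment> \<open>Rounding up costs the summand 1 in the bound on \<open>card B\<close>.\<close>
    moreover have "real d \<le> c * ?L + 1"
      using assms(1) L by (simp add: d_def)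
    ultimately have cardB: "real (card B) \<le> 1 + (c + 2) * ?L"
      using of_nat_mono[OF B(2), where 'a = real] by (simp add: distrib_right)
    have "(\<Sum>u\<in>{1..n}. length (b u)) = (\<Sum>u\<in>B. length (b u))"
      using B(1,3) by (intro sum.mono_neutral_right) auto
    also have "\<dots> \<le> card B * (3 * n)"
      using sum_bounded_above[of B "\<lambda>u. length (b u)" "3 * n"] B(4) by simp
    finally have "real (\<Sum>u\<in>{1..n}. length (b u)) \<le> real (card B * (3 * n))"
      by (simp only: of_nat_le_iff)
    also have "\<dots> = real (card B) * (3 * n)"
      by simp
    also have "\<dots> \<le> (1 + (c + 2) * ?L) * (3 * n)"
      using cardB by (intro mult_right_mono) auto
    also have "\<dots> = (3 / ?L + 3 * c + 6) * n * ?L"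
      using L by (simp add: field_simps)
    also have "\<dots> < (3 * c + 20) * real n * ?L"
    proof -
      \<comment> \<open>The coefficient is thus at most 3c + 9, well below 3c + 20.\<close>
      have "3 / ?L \<le> 3" using L by (simp add: divide_le_eq)
      then show ?thesis
        using L n by (intro mult_strict_right_mono) auto
    qed
    finally have "real (\<Sum>u\<in>{1..n}. length (b u)) < (3 * c + 20) * real n * ?L" .
    moreover have "real (card B) \<le> 1 + (c + 3) * ?L"
      using cardB L by (simp add: distrib_right)
    moreover have "\<forall>u\<in>{1..n} - B. real (length (b u)) \<le> real_of_int \<lceil>log 2 (real n + 1)\<rceil> + real 0"
    proof
      fix u assume "u \<in> {1..n} - B"
      moreover have "- 1 < log 2 (real n + 1)"
        by (rule less_le_trans[of _ 0]) simp_all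
      ultimately show "real (length (b u)) \<le> real_of_int \<lceil>log 2 (real n + 1)\<rceil> + real 0"
        using B(3) by simp
    qed
    ultimately show "\<exists>R b B. routing_scheme n E R \<and> stretch_at_most n E R 1.5 \<and> stored_by Dec n E R b \<and>
        B \<subseteq> {1..n} \<and> real (card B) \<le> 1 + (c + 3) * log 2 (real n) \<and>
        (\<forall>u\<in>{1..n} - B. real (length (b u)) \<le> real_of_int \<lceil>log 2 (real n + 1)\<rceil> + real 0) \<and>
        (\<forall>u\<in>B. length (b u) \<le> 3 * n) \<and>
        real (\<Sum>u\<in>{1..n}. length (b u)) < (3 * c + 20) * real n * log 2 (real n)"
      using scheme B(1,4) by blast
  qed
qed

end
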